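(* Let $(H,\Phi,\eta,e,E)$ be a semisimple formal Frobenius manifold over $\mathbb{C}$ (with flat identity $e$ and Euler element $E$). Then the domain of convergence of the formal power series $\Phi\in\mathbb{C}[\![t^1,\dots,t^n]\!]$ is non-empty.
   Context: Let $k=\mathbb{C}$, let $H$ be a $\mathbb C$-vector space of finite dimension $n$, and let $\eta\colon H\otimes H\to \mathbb{C}$ be a symmetric pairing inducing an isomorphism of $H$ with its dual. Fix a basis $(\Delta_1,\dots,\Delta_n)$ of $H$ with dual coordinates $\boldsymbol t=(t^1,\dots,t^n)$. Put $K=\mathbb{C}[\![\boldsymbol t]\!]$ and $H_K=K\otimes_{\mathbb C}H$; elements of $H_K$ are identified with $\mathbb C$-linear derivations of $K$ via $\Delta_\alpha\leftrightarrow\partial_\alpha=\partial/\partial t^\alpha$, and $\eta$ is extended $K$-bilinearly to $H_K$. Set $\eta_{\alpha\beta}=\eta(\Delta_\alpha,\Delta_\beta)$ and let $(\eta^{\alpha\beta})$ be the inverse matrix; repeated Greek indices are summed; lower indices on $\Phi$ denote partial derivatives. A formal Frobenius manifold structure on $(H,\eta)$ is a series $\Phi\in K$ satisfying the WDVV equations $$\Phi_{\alpha\beta\gamma}\eta^{\gamma\delta}\Phi_{\delta\epsilon\phi}=\Phi_{\phi\beta\gamma}\eta^{\gamma\delta}\Phi_{\delta\epsilon\alpha},\qquad \alpha,\beta,\epsilon,\phi=1,\dots,n.$$ It defines a commutative associative $K$-bilinear product on $H_K$ by $\Delta_\alpha\circ\Delta_\beta=c_{\alpha\beta}^\gamma\Delta_\gamma$,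 $c_{\alpha\beta}^\gamma=\Phi_{\alpha\beta\delta}\eta^{\delta\gamma}$. Throughout, there is a flat identity $e=\Delta_1\in H$, i.e. $e$ is the unit for $\circ$, and an Euler element $E\in H_K$, i.e. for some $D\in \mathbb{C}$ and all $X,Y\in H_K$ $$E(\eta(X,Y))-\eta([E,X],Y)-\eta(X,[E,Y])=D\,\eta(X,Y),$$ $$[E,X\circ Y]-[E,X]\circ Y-X\circ[E,Y]=X\circ Y$$ (equivalently, $\mathfrak L_E\eta=D\eta$ and $\mathfrak L_Ec=c$). The formal Frobenius manifold is semisimple if the $\mathbb{C}$-algebra $(H,\circ_0)$, with structure constants $c_{\alpha\beta}^\gamma(0)$, is isomorphic to $\mathbb{C}^n$ (equivalently, $(H_K,\circ)\cong K^n$ as a $K$-algebra). The domain of convergence of $\Phi$ is the open set given by the interior of the set of points of $H\cong\mathbb C^n$ at which the power series converges absolutely; its non-emptiness means that $\Phi$ is a convergent power series, $\Phi\in\mathbb{C}\{\boldsymbol t\}$. *)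

theory Defs
  imports "HOL-Analysis.Analysis"
begin

section \<open>Formal power series in finitely many variables\<close>

text \<open>The variables are indexed by a finite type \<open>'n\<close>, the multi-indices are the vectors in
  \<open>nat^'n\<close>, and a series is the family of its coefficients.\<close>

typedef ('a, 'n) mfps = "UNIV :: (nat^'n::finite \<Rightarrow> 'a) set"
  morphisms mfps_nth Abs_mfps by auto

notation mfps_nth (infixl "$$" 75)

lemma mfps_eqI: "(\<And>m. f $$ m = g $$ m) \<Longrightarrow> f = g"
  by (simp add: mfps_nth_inject [symmetric] fun_eq_iff)

lemma mfps_nth_Abs [simp]: "Abs_mfps c $$ m = c m"
  by (simp add: Abs_mfps_inverse)

instantiation mfps :: (zero, finite) zero
begin
definition "0 = Abs_mfps (\<lambda>m. 0)"
instance ..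
end

instantiation mfps :: (plus, finite) plus
begin
definition "f + g = Abs_mfps (\<lambda>m. f $$ m + g $$ m)"
instance ..
end

instantiation mfps :: (minus, finite) minus
begin
definition "f - g = Abs_mfps (\<lambda>m. f $$ m - g $$ m)"
instance ..
end

instantiation mfps :: (uminus, finite) uminus
begin
definition "- f = Abs_mfps (\<lambda>m. - (f $$ m))"
instance ..
end

instantiation mfps :: ("{comm_monoid_add, times}", finite) times
begin
definition "f * g = Abs_mfps (\<lambda>m. \<Sum>(a, b) \<in> {(a, b). a + b = m}. f $$ a * g $$ b)"
instance ..
end

definition mfps_const :: "'a::zero \<Rightarrow> ('a, 'n::finite) mfps"
  where "mfps_const c = Abs_mfps (\<lambda>m. if m = 0 then c else 0)"

instantiation mfps :: ("{zero, one}", finite) one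
begin
definition "1 = mfps_const 1"
instance ..
end

lemma mfps_nth_zero [simp]: "0 $$ m = 0"
  by (simp add: zero_mfps_def)

lemma mfps_nth_add [simp]: "(f + g) $$ m = f $$ m + g $$ m"
  by (simp add: plus_mfps_def)

lemma mfps_nth_minus [simp]: "(f - g) $$ m = f $$ m - g $$ m"
  by (simp add: minus_mfps_def)

lemma mfps_nth_uminus [simp]: "(- f) $$ m = - (f $$ m)"
  by (simp add: uminus_mfps_def)

lemma mfps_nth_times: "(f * g) $$ m = (\<Sum>(a, b) \<in> {(a, b). a + b = m}. f $$ a * g $$ b)"
  by (simp add: times_mfps_def)

lemma mfps_nth_const: "mfps_const c $$ m = (if m = 0 then c else 0)"
  by (simp add: mfps_const_def)

lemma mfps_nth_one: "1 $$ m = (if m = 0 then 1 else 0)"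
  by (simp add: one_mfps_def mfps_nth_const)

lemma finite_multi_index_le: "finite {a :: nat^'n::finite. a \<le> m}"
proof (rule finite_subset)
  show "{a. a \<le> m} \<subseteq> vec_lambda ` (PiE UNIV (\<lambda>i. {..m $ i}))"
  proof
    fix a :: "nat^'n" assume "a \<in> {a. a \<le> m}"
    then have "vec_nth a \<in> PiE UNIV (\<lambda>i. {..m $ i})"
      by (auto simp: less_eq_vec_def)
    then show "a \<in> vec_lambda ` (PiE UNIV (\<lambda>i. {..m $ i}))"
      by (metis image_eqI vec_nth_inverse)
  qed
qed (auto intro!: finite_imageI finite_PiE)

lemma finite_multi_index_split: "finite {(a, b :: nat^'n::finite). a + b = m}"
proof (rule finite_subset)
  show "{(a, b). a + b = m} \<subseteq> {a. a \<le> m} \<times> {b. b \<le> m}"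
    by (auto simp: less_eq_vec_def)
qed (simp add: finite_multi_index_le)

instance mfps :: (comm_ring_1, finite) comm_ring_1
proof
  fix f g h :: "('a, 'b) mfps"
  show "f * g * h = f * (g * h)"
  proof (rule mfps_eqI)
    fix m :: "nat^'b"
    have "(f * g * h) $$ m =
        (\<Sum>x\<in>{(d, c). d + c = m}. \<Sum>y\<in>{(a, b). a + b = fst x}. f $$ fst y * g $$ snd y * h $$ snd x)"
      by (simp add: mfps_nth_times sum_distrib_right case_prod_unfold)
    also have "\<dots> = (\<Sum>(x, y)\<in>(SIGMA x:{(d, c). d + c = m}. {(a, b). a + b = fst x}).
        f $$ fst y * g $$ snd y * h $$ snd x)"
      by (rule sum.Sigma) (auto intro: finite_multi_index_split)
    also have "\<dots> = (\<Sum>(x, y)\<in>(SIGMA x:{(a, d). a + d = m}. {(b, c). b + c = snd x}).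
        f $$ fst x * (g $$ fst y * h $$ snd y))"
      by (rule sum.reindex_bij_witness
            [of _ "\<lambda>((a, d), (b, c)). ((a + b, c), (a, b))" "\<lambda>((d, c), (a, b)). ((a, b + c), (b, c))"])
         (auto simp: algebra_simps)
    also have "\<dots> =
        (\<Sum>x\<in>{(a, d). a + d = m}. \<Sum>y\<in>{(b, c). b + c = snd x}. f $$ fst x * (g $$ fst y * h $$ snd y))"
      by (rule sum.Sigma [symmetric]) (auto intro: finite_multi_index_split)
    also have "\<dots> = (f * (g * h)) $$ m"
      by (simp add: mfps_nth_times sum_distrib_left case_prod_unfold)
    finally show "(f * g * h) $$ m = (f * (g * h)) $$ m" .
  qed
  show "f * g = g * f"
    by (rule mfps_eqI, unfold mfps_nth_times,
        rule sum.reindex_bij_witness [of _ "\<lambda>(a, b). (b, a)" "\<lambda>(a, b). (b, a)"])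
       (auto simp: algebra_simps)
  show "1 * f = f"
  proof (rule mfps_eqI)
    fix m :: "nat^'b"
    have "(1 * f) $$ m = (\<Sum>(a, b)\<in>{(0, m)}. (1 :: ('a, 'b) mfps) $$ a * f $$ b)"
      unfolding mfps_nth_times
      by (rule sum.mono_neutral_right)
         (auto simp: mfps_nth_one finite_multi_index_split split: if_splits)
    then show "(1 * f) $$ m = f $$ m"
      by (simp add: mfps_nth_one)
  qed
  show "(f + g) * h = f * h + g * h"
    by (rule mfps_eqI)
       (simp add: mfps_nth_times sum.distrib [symmetric] case_prod_unfold algebra_simps)
  have "(0 :: ('a, 'b) mfps) $$ 0 \<noteq> (1 :: ('a, 'b) mfps) $$ 0"
    by (simp add: mfps_nth_one)
  then show "(0 :: ('a, 'b) mfps) \<noteq> 1"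
    by metis
qed (auto intro!: mfps_eqI)

definition mfps_pderiv :: "'n::finite \<Rightarrow> ('a::comm_ring_1, 'n) mfps \<Rightarrow> ('a, 'n) mfps"
  where "mfps_pderiv \<alpha> f = Abs_mfps (\<lambda>m. of_nat (m $ \<alpha> + 1) * f $$ (m + axis \<alpha> 1))"

definition abs_conv_points :: "(complex, 'n::finite) mfps \<Rightarrow> (complex^'n) set"
  where "abs_conv_points f =
    {t. (\<lambda>m. norm (f $$ m * (\<Prod>\<alpha>\<in>UNIV. (t $ \<alpha>) ^ (m $ \<alpha>)))) summable_on UNIV}"

definition convergence_domain :: "(complex, 'n::finite) mfps \<Rightarrow> (complex^'n) set"
  where "convergence_domain f = interior (abs_conv_points f)"


section \<open>Formal vector fields\<close>

text \<open>With \<open>K = \<complex>[[t]]\<close>, an element \<open>X = \<Sum>\<^sub>\<alpha> X\<^sup>\<alpha> \<otimes> \<Delta>\<^sub>\<alpha>\<close> of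
  \<open>H\<^sub>K = K \<otimes> H\<close> is given by the vector of its components \<open>X\<^sup>\<alpha> \<in> K\<close>,
  so \<open>\<Delta>\<^sub>\<alpha>\<close> itself is \<open>axis \<alpha> 1\<close>.\<close>

type_synonym 'n vfield = "(complex, 'n) mfps^'n"

definition vf_apply :: "'n::finite vfield \<Rightarrow> (complex, 'n) mfps \<Rightarrow> (complex, 'n) mfps"
  where "vf_apply X f = (\<Sum>\<alpha>\<in>UNIV. X $ \<alpha> * mfps_pderiv \<alpha> f)"

text \<open>The commutator of the derivations \<open>X\<close> and \<open>Y\<close> of \<open>K\<close>, in components.\<close>

definition lie_bracket :: "'n::finite vfield \<Rightarrow> 'n vfield \<Rightarrow> 'n vfield"
  where "lie_bracket X Y = (\<chi> \<gamma>. vf_apply X (Y $ \<gamma>) - vf_apply Y (X $ \<gamma>))"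


section \<open>Formal Frobenius manifolds\<close>

text \<open>A finite-dimensional complex vector space \<open>H\<close> with basis \<open>\<Delta>\<close> and a symmetric bilinear
  pairing \<open>\<eta>\<close> for which \<open>x \<mapsto> \<eta>(x, -)\<close> is a bijection of \<open>H\<close> onto its dual.\<close>

locale based_metric_space = vector_space scale
  for scale :: "complex \<Rightarrow> 'h::ab_group_add \<Rightarrow> 'h" +
  fixes \<Delta> :: "'n::finite \<Rightarrow> 'h"
    and \<eta> :: "'h \<Rightarrow> 'h \<Rightarrow> complex"
  assumes inj_basis: "inj \<Delta>"
    and independent_basis: "independent (range \<Delta>)"
    and span_basis: "span (range \<Delta>) = UNIV"
    and sym_metric: "\<eta> x y = \<eta> y x"
    and linear_metric: "Vector_Spaces.linear scale (*) (\<eta> x)"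
    and nondegenerate_metric: "bij_betw \<eta> UNIV {\<phi>. Vector_Spaces.linear scale (*) \<phi>}"
begin

definition gram :: "complex^'n^'n"
  where "gram = (\<chi> \<alpha> \<beta>. \<eta> (\<Delta> \<alpha>) (\<Delta> \<beta>))"

definition gram_inv :: "complex^'n^'n"
  where "gram_inv = matrix_inv gram"

definition metric_K :: "'n vfield \<Rightarrow> 'n vfield \<Rightarrow> (complex, 'n) mfps"
  where "metric_K X Y = (\<Sum>\<alpha>\<in>UNIV. \<Sum>\<beta>\<in>UNIV. X $ \<alpha> * Y $ \<beta> * mfps_const (gram $ \<alpha> $ \<beta>))"

definition third_deriv :: "(complex, 'n) mfps \<Rightarrow> 'n \<Rightarrow> 'n \<Rightarrow> 'n \<Rightarrow> (complex, 'n) mfps"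
  where "third_deriv \<Phi> \<alpha> \<beta> \<gamma> = mfps_pderiv \<alpha> (mfps_pderiv \<beta> (mfps_pderiv \<gamma> \<Phi>))"

definition WDVV :: "(complex, 'n) mfps \<Rightarrow> bool"
  where "WDVV \<Phi> \<longleftrightarrow> (\<forall>\<alpha> \<beta> \<epsilon> \<phi>.
    (\<Sum>\<gamma>\<in>UNIV. \<Sum>\<delta>\<in>UNIV.
        third_deriv \<Phi> \<alpha> \<beta> \<gamma> * mfps_const (gram_inv $ \<gamma> $ \<delta>) * third_deriv \<Phi> \<delta> \<epsilon> \<phi>) =
    (\<Sum>\<gamma>\<in>UNIV. \<Sum>\<delta>\<in>UNIV.
        third_deriv \<Phi> \<phi> \<beta> \<gamma> * mfps_const (gram_inv $ \<gamma> $ \<delta>) * third_deriv \<Phi> \<delta> \<epsilon> \<alpha>))"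

text \<open>\<open>struct_const \<Phi> \<alpha> \<beta> \<gamma>\<close> is the coefficient of
  \<open>\<Delta>\<^sub>\<gamma>\<close> in \<open>\<Delta>\<^sub>\<alpha> \<circ> \<Delta>\<^sub>\<beta>\<close>.\<close>

definition struct_const :: "(complex, 'n) mfps \<Rightarrow> 'n \<Rightarrow> 'n \<Rightarrow> 'n \<Rightarrow> (complex, 'n) mfps"
  where "struct_const \<Phi> \<alpha> \<beta> \<gamma> =
    (\<Sum>\<delta>\<in>UNIV. third_deriv \<Phi> \<alpha> \<beta> \<delta> * mfps_const (gram_inv $ \<delta> $ \<gamma>))"

definition prod_K :: "(complex, 'n) mfps \<Rightarrow> 'n vfield \<Rightarrow> 'n vfield \<Rightarrow> 'n vfield"
  where "prod_K \<Phi> X Y =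
    (\<chi> \<gamma>. \<Sum>\<alpha>\<in>UNIV. \<Sum>\<beta>\<in>UNIV. X $ \<alpha> * Y $ \<beta> * struct_const \<Phi> \<alpha> \<beta> \<gamma>)"

definition euler_element :: "(complex, 'n) mfps \<Rightarrow> 'n vfield \<Rightarrow> bool"
  where "euler_element \<Phi> E \<longleftrightarrow>
    (\<exists>D. \<forall>X Y.
      vf_apply E (metric_K X Y) - metric_K (lie_bracket E X) Y - metric_K X (lie_bracket E Y)
        = mfps_const D * metric_K X Y) \<and>
    (\<forall>X Y.
      lie_bracket E (prod_K \<Phi> X Y) - prod_K \<Phi> (lie_bracket E X) Y - prod_K \<Phi> X (lie_bracket E Y)
        = prod_K \<Phi> X Y)"

definition coord :: "'n \<Rightarrow> 'h \<Rightarrow> complex"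
  where "coord \<alpha> x = representation (range \<Delta>) x (\<Delta> \<alpha>)"

text \<open>The product \<open>\<circ>\<^sub>0\<close> on \<open>H\<close>, whose structure constants are the constant
  terms \<open>c\<^sub>\<alpha>\<^sub>\<beta>\<^sup>\<gamma>(0)\<close>.\<close>

definition prod_0 :: "(complex, 'n) mfps \<Rightarrow> 'h \<Rightarrow> 'h \<Rightarrow> 'h"
  where "prod_0 \<Phi> x y = (\<Sum>\<gamma>\<in>UNIV. scale
    (\<Sum>\<alpha>\<in>UNIV. \<Sum>\<beta>\<in>UNIV. coord \<alpha> x * coord \<beta> y * (struct_const \<Phi> \<alpha> \<beta> \<gamma> $$ 0)) (\<Delta> \<gamma>))"

text \<open>\<open>(H, \<circ>\<^sub>0)\<close> is isomorphic to \<open>\<complex>\<^sup>n\<close>, the multiplication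
  of \<open>complex^'n\<close> being componentwise. A multiplicative bijection automatically preserves the unit.\<close>

definition semisimple_at_0 :: "(complex, 'n) mfps \<Rightarrow> bool"
  where "semisimple_at_0 \<Phi> \<longleftrightarrow>
    (\<exists>f :: 'h \<Rightarrow> complex^'n. Vector_Spaces.linear scale (*s) f \<and> bij f \<and>
      (\<forall>x y. f (prod_0 \<Phi> x y) = f x * f y))"

end

text \<open>The index type carries no order, so the basis vector called \<open>\<Delta>\<^sub>1\<close>, the flat
  identity, is the one at a chosen index \<open>i\<^sub>1\<close>.\<close>

locale formal_frobenius_manifold = based_metric_space scale \<Delta> \<eta>
  for scale :: "complex \<Rightarrow> 'h::ab_group_add \<Rightarrow> 'h"
    and \<Delta> :: "'n::finite \<Rightarrow> 'h"
    and \<eta> :: "'h \<Rightarrow> 'h \<Rightarrow> complex" +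
  fixes \<Phi> :: "(complex, 'n) mfps"
    and i\<^sub>1 :: 'n
    and E :: "'n vfield"
  assumes wdvv: "WDVV \<Phi>"
    and flat_identity: "prod_K \<Phi> (axis i\<^sub>1 1) X = X" "prod_K \<Phi> X (axis i\<^sub>1 1) = X"
    and euler: "euler_element \<Phi> E"

locale semisimple_formal_frobenius_manifold = formal_frobenius_manifold +
  assumes semisimple: "semisimple_at_0 \<Phi>"

end

theory Submission
  imports Defs
begin

text \<open>The third derivatives of the potential are series in the flat coordinates that solve a
  polynomial differential equation along a suitable vector field with a nondegenerate zero at the origin,
  and a formal solution of such an equation converges.

  Let \<open>C\<^sub>\<alpha>\<close> be the multiplication by \<open>\<Delta>\<^sub>\<alpha>\<close> and \<open>U\<close> the multiplication by
  the Euler field. The Euler condition gives \<open>\<partial>\<^sub>\<alpha> U = C\<^sub>\<alpha> + [C\<^sub>\<alpha>, \<nabla>E]\<close> with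
  \<open>\<nabla>E\<close> constant. If the eigenvalues of \<open>U(0)\<close> are distinct, the
  \<open>C\<^sub>\<alpha>\<close> are analytic functions of \<open>U\<close> and this is a regular differential equation for
  \<open>U\<close>; in general some of them coincide, and the equation becomes singular. It is then replaced by an
  equation for \<open>U\<close> and the \<open>C\<^sub>\<alpha>\<close> along a single vector field.

  Choose a polynomial \<open>h\<close> that vanishes with derivative \<open>1\<close> at every eigenvalue of \<open>U(0)\<close>, and let \<open>W = h(E)\<close>, computed with the product \<open>\<circ>\<close>.
  Then:

  \<^item> The multiplication by \<open>W\<close> is \<open>h(U)\<close>. By the symmetry
    \<open>\<partial>\<^sub>\<alpha> C\<^sub>\<beta> = \<partial>\<^sub>\<beta> C\<^sub>\<alpha>\<close>, the derivative of \<open>C\<^sub>\<beta>\<close> along \<open>W\<close> is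
    \<open>\<partial>\<^sub>\<beta> h(U) - C\<close>, where \<open>C\<close> is the multiplication by \<open>\<partial>\<^sub>\<beta> W\<close>. This is a
    polynomial in the entries of the \<open>C\<^sub>\<alpha>\<close>, of \<open>U\<close> and of \<open>\<nabla>E\<close>
    (\<open>spectral_field_apply_c\<close>). So these entries satisfy a closed polynomial system along
    \<open>W\<close>, and \<open>W\<close> is a polynomial in them.

  \<^item> The field \<open>W\<close> agrees with the radial field \<open>\<Sum>\<^sub>\<alpha> t\<^sup>\<alpha> \<partial>\<^sub>\<alpha>\<close> up to terms of
    order two (\<open>spectral_field_nth_0\<close>, \<open>spectral_field_nth_axis\<close>). Here semisimplicity
    enters: at the origin the matrices of the multiplications are simultaneously diagonal, so
    \<open>U(0)\<close> is annihilated by \<open>h\<close> and \<open>\<partial>\<^sub>\<alpha> h(U)\<close> has the same diagonal as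
    \<open>C\<^sub>\<alpha>\<close>. In canonical coordinates, \<open>W\<close> is
    \<open>\<Sum>\<^sub>i h(u\<^sub>i) \<partial> / \<partial>u\<^sub>i\<close> with
    \<open>h(u\<^sub>i) = u\<^sub>i - u\<^sub>i(0) + \<dots>\<close>.

  A formal solution of such a system converges (\<open>Euler_type_system_convergent\<close>): the radial field
  acts on the part of degree \<open>k\<close> as multiplication by \<open>k\<close>, which for large \<open>k\<close> outweighs
  the linear part of the right-hand side whatever its eigenvalues are. This is a majorant argument with the
  \<open>\<ell>\<^sup>1\<close> norms of the homogeneous parts. Finally, the coefficients of the potential in degree at
  least three are dominated by those of its third derivatives.\<close>


section \<open>Formal power series\<close>

lemma mfps_nth_sum: "(\<Sum>i\<in>I. f i) $$ m = (\<Sum>i\<in>I. f i $$ m)"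
  by (induction I rule: infinite_finite_induct) auto

lemma multi_index_sum_eq_0_iff: "a + b = (0 :: nat^'n::finite) \<longleftrightarrow> a = 0 \<and> b = 0"
  by (auto simp: vec_eq_iff)

lemma mfps_nth_times_0 [simp]:
  fixes f g :: "('a::comm_ring_1, 'n::finite) mfps"
  shows "(f * g) $$ 0 = f $$ 0 * g $$ 0"
proof -
  have "{(a, b). a + b = (0 :: nat^'n)} = {(0, 0)}"
    by (auto simp: multi_index_sum_eq_0_iff)
  then show ?thesis
    by (simp add: mfps_nth_times)
qed

lemma mfps_const_nth_0 [simp]: "mfps_const c $$ 0 = c"
  by (simp add: mfps_nth_const)

lemma mfps_nth_const_times:
  fixes f :: "('a::comm_ring_1, 'n::finite) mfps"
  shows "(mfps_const c * f) $$ m = c * f $$ m"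
proof -
  have "(mfps_const c * f) $$ m = (\<Sum>(a, b)\<in>{(0, m)}. (mfps_const c :: ('a, 'n) mfps) $$ a * f $$ b)"
    unfolding mfps_nth_times
    by (rule sum.mono_neutral_right)
       (auto simp: mfps_nth_const finite_multi_index_split split: if_splits)
  then show ?thesis
    by simp
qed

lemma mfps_const_0 [simp]: "mfps_const 0 = 0"
  by (rule mfps_eqI) (simp add: mfps_nth_const)

lemma mfps_const_1 [simp]: "mfps_const 1 = 1"
  by (simp add: one_mfps_def)

lemma mfps_const_add: "mfps_const (a + b) = mfps_const a + (mfps_const b :: ('a::comm_ring_1, 'n::finite) mfps)"
  by (rule mfps_eqI) (simp add: mfps_nth_const)

lemma mfps_const_mult: "mfps_const (a * b) = mfps_const a * (mfps_const b :: ('a::comm_ring_1, 'n::finite) mfps)"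
  by (rule mfps_eqI) (simp add: mfps_nth_const_times, simp add: mfps_nth_const)

lemma mfps_const_uminus: "mfps_const (- a) = - (mfps_const a :: ('a::comm_ring_1, 'n::finite) mfps)"
  by (rule mfps_eqI) (simp add: mfps_nth_const)

lemma mfps_const_sum: "mfps_const (\<Sum>i\<in>I. f i) = (\<Sum>i\<in>I. mfps_const (f i) :: ('a::comm_ring_1, 'n::finite) mfps)"
  by (induction I rule: infinite_finite_induct) (auto simp: mfps_const_add)

lemma mfps_pderiv_nth: "mfps_pderiv \<alpha> f $$ m = of_nat (m $ \<alpha> + 1) * f $$ (m + axis \<alpha> 1)"
  by (simp add: mfps_pderiv_def)

lemma mfps_pderiv_add: "mfps_pderiv \<alpha> (f + g) = mfps_pderiv \<alpha> f + mfps_pderiv \<alpha> g"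
  by (rule mfps_eqI) (simp add: mfps_pderiv_nth algebra_simps)

lemma mfps_pderiv_0 [simp]: "mfps_pderiv \<alpha> 0 = 0"
  by (rule mfps_eqI) (simp add: mfps_pderiv_nth)

lemma mfps_pderiv_sum: "mfps_pderiv \<alpha> (\<Sum>i\<in>I. f i) = (\<Sum>i\<in>I. mfps_pderiv \<alpha> (f i))"
  by (induction I rule: infinite_finite_induct) (auto simp: mfps_pderiv_add)

lemma mfps_pderiv_commute: "mfps_pderiv \<alpha> (mfps_pderiv \<beta> f) = mfps_pderiv \<beta> (mfps_pderiv \<alpha> f)"
proof (cases "\<alpha> = \<beta>")
  case False
  then have "axis \<alpha> (1::nat) $ \<beta> = 0" "axis \<beta> (1::nat) $ \<alpha> = 0"
    by (simp_all add: axis_def)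
  moreover have "m + axis \<alpha> 1 + axis \<beta> 1 = m + axis \<beta> 1 + axis \<alpha> (1::nat)" for m
    by (simp add: ac_simps)
  ultimately show ?thesis
    by (intro mfps_eqI) (simp add: mfps_pderiv_nth)
qed simp

lemma multi_index_minus_axis:
  fixes m :: "nat^'n::finite"
  assumes "m $ \<alpha> \<noteq> 0"
  shows "m - axis \<alpha> 1 + axis \<alpha> 1 = m"
  using assms by (auto simp: vec_eq_iff axis_def)

lemma multi_index_split_minus_axis:
  fixes a b m :: "nat^'n::finite"
  assumes "a $ \<alpha> \<noteq> 0" "a + b = m + axis \<alpha> 1"
  shows "a - axis \<alpha> 1 + b = m"
proof -
  have "(a - axis \<alpha> 1 + b) + axis \<alpha> 1 = (a - axis \<alpha> 1 + axis \<alpha> 1) + b"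
    by (simp add: ac_simps)
  also have "\<dots> = m + axis \<alpha> 1"
    using assms by (simp add: multi_index_minus_axis del: One_nat_def)
  finally show ?thesis
    by simp
qed

lemma multi_index_split_minus_axis':
  fixes a b m :: "nat^'n::finite"
  assumes "b $ \<alpha> \<noteq> 0" "a + b = m + axis \<alpha> 1"
  shows "a + (b - axis \<alpha> 1) = m"
  using multi_index_split_minus_axis [of b \<alpha> a m] assms by (simp add: add.commute)

text \<open>Both sides of the product rule are sums over the ways of splitting \<open>m + axis \<alpha> 1\<close> into
  two multi-indices; the factor \<open>m $ \<alpha> + 1\<close> is the sum of the two exponents of the
  variable, and a summand with vanishing exponent contributes to one of the two terms only.\<close>

lemma mfps_pderiv_mult:
  fixes f g :: "('a::comm_ring_1, 'n::finite) mfps"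
  shows "mfps_pderiv \<alpha> (f * g) = mfps_pderiv \<alpha> f * g + f * mfps_pderiv \<alpha> g"
proof (rule mfps_eqI)
  fix m :: "nat^'n"
  let ?x = "axis \<alpha> 1 :: nat^'n"
  let ?S = "{(a, b). a + b = m + ?x}"
  have swap: "a + ?x + b = a + b + ?x" for a b
    by (simp add: ac_simps)
  have left: "(mfps_pderiv \<alpha> f * g) $$ m = (\<Sum>(a, b)\<in>?S. of_nat (a $ \<alpha>) * f $$ a * g $$ b)"
  proof -
    have "(mfps_pderiv \<alpha> f * g) $$ m =
        (\<Sum>(a, b)\<in>{(a, b). (a, b) \<in> ?S \<and> a $ \<alpha> \<noteq> 0}. of_nat (a $ \<alpha>) * f $$ a * g $$ b)"
      unfolding mfps_nth_times
      by (rule sum.reindex_bij_witness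
            [of _ "\<lambda>(a, b). (a - ?x, b)" "\<lambda>(a, b). (a + ?x, b)"])
         (auto simp: swap mfps_pderiv_nth multi_index_minus_axis multi_index_split_minus_axis
               mult.assoc [symmetric] simp del: One_nat_def)
    also have "\<dots> = (\<Sum>(a, b)\<in>?S. of_nat (a $ \<alpha>) * f $$ a * g $$ b)"
      by (rule sum.mono_neutral_left) (auto simp: finite_multi_index_split intro!: gr0I)
    finally show ?thesis .
  qed
  have right: "(f * mfps_pderiv \<alpha> g) $$ m = (\<Sum>(a, b)\<in>?S. of_nat (b $ \<alpha>) * f $$ a * g $$ b)"
  proof -
    have "(f * mfps_pderiv \<alpha> g) $$ m =
        (\<Sum>(a, b)\<in>{(a, b). (a, b) \<in> ?S \<and> b $ \<alpha> \<noteq> 0}. of_nat (b $ \<alpha>) * f $$ a * g $$ b)"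
      unfolding mfps_nth_times
      by (rule sum.reindex_bij_witness
            [of _ "\<lambda>(a, b). (a, b - ?x)" "\<lambda>(a, b). (a, b + ?x)"])
         (auto simp: mfps_pderiv_nth multi_index_minus_axis multi_index_split_minus_axis'
               add.assoc [symmetric] mult.assoc mult.left_commute
               simp del: One_nat_def)
    also have "\<dots> = (\<Sum>(a, b)\<in>?S. of_nat (b $ \<alpha>) * f $$ a * g $$ b)"
      by (rule sum.mono_neutral_left) (auto simp: finite_multi_index_split intro!: gr0I)
    finally show ?thesis .
  qed
  have "mfps_pderiv \<alpha> (f * g) $$ m = (\<Sum>(a, b)\<in>?S. of_nat (m $ \<alpha> + 1) * (f $$ a * g $$ b))"
    by (simp add: mfps_pderiv_nth mfps_nth_times sum_distrib_left case_prod_unfold)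
  also have "\<dots> = (\<Sum>(a, b)\<in>?S. of_nat (a $ \<alpha>) * f $$ a * g $$ b + of_nat (b $ \<alpha>) * f $$ a * g $$ b)"
  proof (rule sum.cong [OF refl], clarify)
    fix a b assume "a + b = m + ?x"
    then have "(a + b) $ \<alpha> = (m + ?x) $ \<alpha>"
      by simp
    then have eq: "m $ \<alpha> + 1 = a $ \<alpha> + b $ \<alpha>"
      by (simp add: axis_def)
    show "of_nat (m $ \<alpha> + 1) * (f $$ a * g $$ b) =
        of_nat (a $ \<alpha>) * f $$ a * g $$ b + of_nat (b $ \<alpha>) * f $$ a * g $$ b"
      unfolding eq by (simp add: algebra_simps)
  qed
  also have "\<dots> = (mfps_pderiv \<alpha> f * g + f * mfps_pderiv \<alpha> g) $$ m"
    by (simp add: left right sum.distrib [symmetric] case_prod_unfold)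
  finally show "mfps_pderiv \<alpha> (f * g) $$ m = (mfps_pderiv \<alpha> f * g + f * mfps_pderiv \<alpha> g) $$ m" .
qed

lemma mfps_pderiv_const [simp]: "mfps_pderiv \<alpha> (mfps_const c) = 0"
  by (rule mfps_eqI) (auto simp: mfps_pderiv_nth mfps_nth_const vec_eq_iff axis_def)

lemma mfps_pderiv_1 [simp]: "mfps_pderiv \<alpha> 1 = 0"
  by (metis mfps_const_1 mfps_pderiv_const)

lemma mfps_pderiv_const_times:
  "mfps_pderiv \<alpha> (mfps_const c * f) = mfps_const c * mfps_pderiv \<alpha> f"
  by (simp add: mfps_pderiv_mult)

definition mfps_var :: "'n::finite \<Rightarrow> ('a::{zero, one}, 'n) mfps"
  where "mfps_var \<alpha> = Abs_mfps (\<lambda>m. if m = axis \<alpha> 1 then 1 else 0)"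

lemma mfps_nth_var_times:
  fixes f :: "('a::comm_ring_1, 'n::finite) mfps"
  shows "(mfps_var \<alpha> * f) $$ m = (if m $ \<alpha> = 0 then 0 else f $$ (m - axis \<alpha> 1))"
proof -
  let ?x = "axis \<alpha> 1 :: nat^'n"
  have "{(a, b). a + b = m \<and> a = ?x} = (if m $ \<alpha> = 0 then {} else {(?x, m - ?x)})"
    using multi_index_minus_axis [of m \<alpha>] by (auto simp: add.commute simp del: One_nat_def)
  moreover have "(mfps_var \<alpha> * f) $$ m =
      (\<Sum>(a, b)\<in>{(a, b). a + b = m \<and> a = ?x}. (mfps_var \<alpha> :: ('a, 'n) mfps) $$ a * f $$ b)"
    unfolding mfps_nth_times
    by (rule sum.mono_neutral_right)
       (auto simp: mfps_var_def finite_multi_index_split split: if_splits)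
  ultimately show ?thesis
    by (simp add: mfps_var_def)
qed


section \<open>The homogeneous parts of a series\<close>

definition multi_degree :: "nat^'n::finite \<Rightarrow> nat"
  where "multi_degree m = (\<Sum>\<alpha>\<in>UNIV. m $ \<alpha>)"

lemma multi_degree_add: "multi_degree (a + b) = multi_degree a + multi_degree b"
  by (simp add: multi_degree_def sum.distrib)

lemma multi_degree_axis [simp]: "multi_degree (axis \<alpha> k) = k"
  by (simp add: multi_degree_def axis_def)

lemma multi_degree_eq_0: "multi_degree m = 0 \<longleftrightarrow> m = 0"
  by (auto simp: multi_degree_def vec_eq_iff)

lemma component_le_multi_degree: "m $ \<alpha> \<le> multi_degree m"
  by (simp add: multi_degree_def member_le_sum)

lemma multi_degree_1E:
  fixes m :: "nat^'n::finite"
  assumes "multi_degree m = 1"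
  obtains \<alpha> where "m = axis \<alpha> 1"
proof -
  from assms obtain \<alpha> where "m $ \<alpha> \<noteq> 0"
    by (metis multi_degree_eq_0 one_neq_zero vec_eq_iff zero_index)
  then have m: "m - axis \<alpha> 1 + axis \<alpha> 1 = m"
    by (rule multi_index_minus_axis)
  then have "multi_degree (m - axis \<alpha> 1) + 1 = 1"
    using assms multi_degree_add [of "m - axis \<alpha> 1" "axis \<alpha> 1"] by simp
  then have "m - axis \<alpha> 1 = 0"
    by (simp add: multi_degree_eq_0)
  then show ?thesis
    using m that by (metis add_0)
qed

lemma finite_multi_degree: "finite {m :: nat^'n::finite. multi_degree m = k}"
  by (rule finite_subset [OF _ finite_multi_index_le [of "\<chi> i. k"]])
     (auto simp: less_eq_vec_def intro: component_le_multi_degree)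

definition degree_norm :: "nat \<Rightarrow> (complex, 'n::finite) mfps \<Rightarrow> real"
  where "degree_norm k f = (\<Sum>m | multi_degree m = k. norm (f $$ m))"

lemma degree_norm_nonneg [simp]: "0 \<le> degree_norm k f"
  by (simp add: degree_norm_def sum_nonneg)

lemma degree_norm_0 [simp]: "degree_norm k 0 = 0"
  by (simp add: degree_norm_def)

lemma degree_norm_eq_0I: "(\<And>m. multi_degree m = k \<Longrightarrow> f $$ m = 0) \<Longrightarrow> degree_norm k f = 0"
  by (simp add: degree_norm_def)

lemma degree_norm_add: "degree_norm k (f + g) \<le> degree_norm k f + degree_norm k g"
  unfolding degree_norm_def sum.distrib [symmetric]
  by (rule sum_mono) (simp add: norm_triangle_ineq)

lemma degree_norm_diff: "degree_norm k (f - g) \<le> degree_norm k f + degree_norm k g"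
  unfolding degree_norm_def sum.distrib [symmetric]
  by (rule sum_mono) (simp add: norm_triangle_ineq4)

lemma degree_norm_sum: "degree_norm k (\<Sum>i\<in>I. f i) \<le> (\<Sum>i\<in>I. degree_norm k (f i))"
  by (induction I rule: infinite_finite_induct)
     (auto intro: order_trans [OF degree_norm_add])

lemma degree_norm_mult:
  fixes f g :: "(complex, 'n::finite) mfps"
  shows "degree_norm k (f * g) \<le> (\<Sum>i\<le>k. degree_norm i f * degree_norm (k - i) g)"
proof -
  let ?D = "\<lambda>k. {m :: nat^'n. multi_degree m = k}"
  have "degree_norm k (f * g) \<le> (\<Sum>m\<in>?D k. \<Sum>x\<in>{(a, b). a + b = m}. norm (f $$ fst x) * norm (g $$ snd x))"
    unfolding degree_norm_def mfps_nth_times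
    by (intro sum_mono order_trans [OF norm_sum]) (simp add: case_prod_unfold norm_mult)
  also have "\<dots> = (\<Sum>(m, x)\<in>(SIGMA m:?D k. {(a, b). a + b = m}). norm (f $$ fst x) * norm (g $$ snd x))"
    by (rule sum.Sigma) (auto simp: finite_multi_degree finite_multi_index_split)
  also have "\<dots> = (\<Sum>(i, x)\<in>(SIGMA i:{..k}. ?D i \<times> ?D (k - i)). norm (f $$ fst x) * norm (g $$ snd x))"
    by (rule sum.reindex_bij_witness
          [of _ "\<lambda>(i, (a, b)). (a + b, (a, b))" "\<lambda>(m, (a, b)). (multi_degree a, (a, b))"])
       (auto simp: multi_degree_add)
  also have "\<dots> = (\<Sum>i\<le>k. \<Sum>x\<in>?D i \<times> ?D (k - i). norm (f $$ fst x) * norm (g $$ snd x))"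
    by (rule sum.Sigma [symmetric]) (auto simp: finite_multi_degree)
  also have "\<dots> = (\<Sum>i\<le>k. degree_norm i f * degree_norm (k - i) g)"
    by (simp add: degree_norm_def sum_product sum.cartesian_product case_prod_unfold)
  finally show ?thesis .
qed

lemma degree_norm_pderiv:
  fixes f :: "(complex, 'n::finite) mfps"
  shows "degree_norm k (mfps_pderiv \<alpha> f) \<le> real (k + 1) * degree_norm (k + 1) f"
proof -
  have "degree_norm k (mfps_pderiv \<alpha> f) \<le>
      (\<Sum>m | multi_degree m = k. real (k + 1) * norm (f $$ (m + axis \<alpha> 1)))"
    unfolding degree_norm_def
  proof (rule sum_mono)
    fix m :: "nat^'n" assume "m \<in> {m. multi_degree m = k}"
    then have "m $ \<alpha> + 1 \<le> k + 1"
      using component_le_multi_degree [of m \<alpha>] by simp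
    then show "norm (mfps_pderiv \<alpha> f $$ m) \<le> real (k + 1) * norm (f $$ (m + axis \<alpha> 1))"
      by (simp only: mfps_pderiv_nth norm_mult norm_of_nat of_nat_le_iff mult_right_mono norm_ge_zero)
  qed
  also have "\<dots> = real (k + 1) * (\<Sum>m\<in>(\<lambda>m. m + axis \<alpha> 1) ` {m. multi_degree m = k}. norm (f $$ m))"
    unfolding sum_distrib_left [symmetric] by (subst sum.reindex) (auto simp: inj_on_def)
  also have "\<dots> \<le> real (k + 1) * degree_norm (k + 1) f"
    unfolding degree_norm_def
    by (intro mult_left_mono sum_mono2 finite_multi_degree) (auto simp: multi_degree_add)
  finally show ?thesis .
qed

text \<open>Every monomial of degree \<open>Suc k\<close> contains some variable, and differentiation with
  respect to that variable multiplies its coefficient by a positive integer.\<close>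

lemma degree_norm_le_pderiv:
  fixes f :: "(complex, 'n::finite) mfps"
  shows "degree_norm (Suc k) f \<le> (\<Sum>\<alpha>\<in>UNIV. degree_norm k (mfps_pderiv \<alpha> f))"
proof -
  let ?D = "\<lambda>k. {m :: nat^'n. multi_degree m = k}"
  let ?shift = "\<lambda>(\<alpha>, m). m + axis \<alpha> 1 :: nat^'n"
  have sub: "?D (Suc k) \<subseteq> ?shift ` (UNIV \<times> ?D k)"
  proof
    fix m assume m: "m \<in> ?D (Suc k)"
    then have "multi_degree m \<noteq> 0"
      by simp
    then obtain \<alpha> where "m $ \<alpha> \<noteq> 0"
      by (auto simp: multi_degree_eq_0 vec_eq_iff)
    then have eq: "m - axis \<alpha> 1 + axis \<alpha> 1 = m"
      by (rule multi_index_minus_axis)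
    then have "multi_degree (m - axis \<alpha> 1) + 1 = Suc k"
      using m multi_degree_add [of "m - axis \<alpha> 1" "axis \<alpha> 1"] by simp
    then show "m \<in> ?shift ` (UNIV \<times> ?D k)"
      using eq by (intro image_eqI [of _ _ "(\<alpha>, m - axis \<alpha> 1)"]) auto
  qed
  have "degree_norm (Suc k) f \<le> (\<Sum>m\<in>?shift ` (UNIV \<times> ?D k). norm (f $$ m))"
    unfolding degree_norm_def by (rule sum_mono2) (use sub in \<open>auto simp: finite_multi_degree\<close>)
  also have "\<dots> \<le> (\<Sum>x\<in>UNIV \<times> ?D k. norm (f $$ ?shift x))"
    using sum_image_le [of "UNIV \<times> ?D k" "\<lambda>m. norm (f $$ m)" ?shift]
    by (simp add: finite_multi_degree comp_def)
  also have "\<dots> = (\<Sum>\<alpha>\<in>UNIV. \<Sum>m\<in>?D k. norm (f $$ (m + axis \<alpha> 1)))"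
    by (simp add: sum.cartesian_product case_prod_unfold)
  also have "\<dots> \<le> (\<Sum>\<alpha>\<in>UNIV. degree_norm k (mfps_pderiv \<alpha> f))"
    unfolding degree_norm_def
  proof (intro sum_mono)
    fix \<alpha> and m :: "nat^'n"
    have "1 * norm (f $$ (m + axis \<alpha> 1)) \<le> real (m $ \<alpha> + 1) * norm (f $$ (m + axis \<alpha> 1))"
      by (rule mult_right_mono) auto
    then show "norm (f $$ (m + axis \<alpha> 1)) \<le> norm (mfps_pderiv \<alpha> f $$ m)"
      by (simp only: mfps_pderiv_nth norm_mult norm_of_nat mult_1)
  qed
  finally show ?thesis .
qed


section \<open>Convergence of formal solutions\<close>

text \<open>The polynomial expressions in the elements of \<open>G\<close>. They take the place of the right-hand
  sides of polynomial differential equations for the series in \<open>G\<close>.\<close>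

inductive_set generated_algebra :: "(complex, 'n::finite) mfps set \<Rightarrow> (complex, 'n) mfps set"
  for G where
    const: "mfps_const c \<in> generated_algebra G"
  | gen: "y \<in> G \<Longrightarrow> y \<in> generated_algebra G"
  | add: "f \<in> generated_algebra G \<Longrightarrow> g \<in> generated_algebra G \<Longrightarrow> f + g \<in> generated_algebra G"
  | mult: "f \<in> generated_algebra G \<Longrightarrow> g \<in> generated_algebra G \<Longrightarrow> f * g \<in> generated_algebra G"

lemma generated_algebra_0: "0 \<in> generated_algebra G"
  using generated_algebra.const [of 0] by simp

lemma generated_algebra_sum:
  "(\<And>i. i \<in> I \<Longrightarrow> f i \<in> generated_algebra G) \<Longrightarrow> (\<Sum>i\<in>I. f i) \<in> generated_algebra G"
  by (induction I rule: infinite_finite_induct)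
     (auto intro: generated_algebra_0 generated_algebra.add)

lemma generated_algebra_uminus:
  assumes "f \<in> generated_algebra G"
  shows "- f \<in> generated_algebra G"
proof -
  have "- f = mfps_const (- 1) * f"
    by (simp add: mfps_const_uminus)
  then show ?thesis
    using assms by (metis generated_algebra.const generated_algebra.mult)
qed

lemma generated_algebra_diff:
  "f \<in> generated_algebra G \<Longrightarrow> g \<in> generated_algebra G \<Longrightarrow> f - g \<in> generated_algebra G"
  using generated_algebra.add [of f G "- g"] generated_algebra_uminus [of g G] by simp

definition weighted_norm :: "real \<Rightarrow> nat \<Rightarrow> (complex, 'n::finite) mfps \<Rightarrow> real"
  where "weighted_norm \<rho> l f = degree_norm l f * \<rho> ^ l"

lemma weighted_norm_nonneg: "0 \<le> \<rho> \<Longrightarrow> 0 \<le> weighted_norm \<rho> l f"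
  by (simp add: weighted_norm_def)

lemma weighted_norm_le: "0 \<le> \<rho> \<Longrightarrow> \<rho> \<le> 1 \<Longrightarrow> weighted_norm \<rho> l f \<le> degree_norm l f"
  by (simp add: weighted_norm_def mult_left_le power_le_one)

lemma weighted_norm_add:
  "0 \<le> \<rho> \<Longrightarrow> weighted_norm \<rho> l (f + g) \<le> weighted_norm \<rho> l f + weighted_norm \<rho> l g"
  unfolding weighted_norm_def distrib_right [symmetric]
  by (rule mult_right_mono [OF degree_norm_add]) simp

lemma weighted_norm_mult:
  assumes "0 \<le> \<rho>"
  shows "weighted_norm \<rho> l (f * g) \<le> (\<Sum>i\<le>l. weighted_norm \<rho> i f * weighted_norm \<rho> (l - i) g)"
proof -
  have "weighted_norm \<rho> l (f * g) \<le> (\<Sum>i\<le>l. degree_norm i f * degree_norm (l - i) g) * \<rho> ^ l"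
    unfolding weighted_norm_def using assms by (intro mult_right_mono degree_norm_mult) auto
  also have "\<dots> = (\<Sum>i\<le>l. weighted_norm \<rho> i f * weighted_norm \<rho> (l - i) g)"
    unfolding sum_distrib_right
  proof (rule sum.cong [OF refl])
    fix i assume "i \<in> {..l}"
    then have "\<rho> ^ l = \<rho> ^ i * \<rho> ^ (l - i)"
      by (simp flip: power_add)
    then show "degree_norm i f * degree_norm (l - i) g * \<rho> ^ l =
        weighted_norm \<rho> i f * weighted_norm \<rho> (l - i) g"
      by (simp add: weighted_norm_def)
  qed
  finally show ?thesis .
qed

text \<open>The sum starts in degree \<open>2\<close>. The part of degree at most \<open>1\<close> of the generators is of
  the order of \<open>1\<close> for small \<open>\<rho>\<close>, whereas the convergence proof needs a quantity
  that is \<open>o(\<rho>)\<close> for each fixed \<open>k\<close>.\<close>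

definition generator_tail :: "(complex, 'n::finite) mfps set \<Rightarrow> nat \<Rightarrow> real \<Rightarrow> real"
  where "generator_tail G k \<rho> = (\<Sum>j\<in>{2..k}. \<Sum>y\<in>G. weighted_norm \<rho> j y)"

lemma generator_tail_nonneg: "0 \<le> \<rho> \<Longrightarrow> 0 \<le> generator_tail G k \<rho>"
  by (simp add: generator_tail_def sum_nonneg weighted_norm_nonneg)

text \<open>A polynomial of degree \<open>d\<close> in the generators has, in total degree above \<open>d\<close>, only terms
  with a factor from the part of degree at least \<open>2\<close> of some generator. Its tail is therefore
  bounded linearly by the tail of the generators, and the point is that \<open>C\<close> and \<open>m\<close>
  depend neither on the truncation \<open>k\<close> nor on \<open>\<rho>\<close>.\<close>

definition tail_bound :: "(complex, 'n::finite) mfps set \<Rightarrow> real \<Rightarrow> nat \<Rightarrow> (complex, 'n) mfps \<Rightarrow> bool"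
  where "tail_bound G C m f \<longleftrightarrow> (\<forall>k \<rho>. 0 \<le> \<rho> \<longrightarrow> \<rho> \<le> 1 \<longrightarrow> generator_tail G k \<rho> \<le> 1 \<longrightarrow>
    (\<Sum>l\<in>{m<..k}. weighted_norm \<rho> l f) \<le> C * generator_tail G k \<rho>)"

lemma tail_boundD:
  "tail_bound G C m f \<Longrightarrow> 0 \<le> \<rho> \<Longrightarrow> \<rho> \<le> 1 \<Longrightarrow> generator_tail G k \<rho> \<le> 1 \<Longrightarrow>
    (\<Sum>l\<in>{m<..k}. weighted_norm \<rho> l f) \<le> C * generator_tail G k \<rho>"
  by (simp add: tail_bound_def)

lemma tail_bound_mono:
  assumes "tail_bound G C m f" "C \<le> C'" "m \<le> m'"
  shows "tail_bound G C' m' f"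
  unfolding tail_bound_def
proof (intro allI impI)
  fix k and \<rho> :: real
  assume \<rho>: "0 \<le> \<rho>" "\<rho> \<le> 1" "generator_tail G k \<rho> \<le> 1"
  have "(\<Sum>l\<in>{m'<..k}. weighted_norm \<rho> l f) \<le> (\<Sum>l\<in>{m<..k}. weighted_norm \<rho> l f)"
    using assms(3) \<rho>(1) by (intro sum_mono2) (auto simp: weighted_norm_nonneg)
  also have "\<dots> \<le> C * generator_tail G k \<rho>"
    using assms(1) \<rho> by (rule tail_boundD)
  also have "\<dots> \<le> C' * generator_tail G k \<rho>"
    using assms(2) \<rho>(1) by (intro mult_right_mono generator_tail_nonneg)
  finally show "(\<Sum>l\<in>{m'<..k}. weighted_norm \<rho> l f) \<le> C' * generator_tail G k \<rho>" .
qed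

lemma tail_bound_total:
  assumes "tail_bound G C m f" "0 \<le> C" "0 \<le> \<rho>" "\<rho> \<le> 1" "generator_tail G k \<rho> \<le> 1"
  shows "(\<Sum>l\<le>k. weighted_norm \<rho> l f) \<le> (\<Sum>l\<le>m. degree_norm l f) + C"
proof -
  have "(\<Sum>l\<le>k. weighted_norm \<rho> l f) \<le> (\<Sum>l\<in>{..m} \<union> {m<..k}. weighted_norm \<rho> l f)"
    using assms(3) by (intro sum_mono2) (auto simp: weighted_norm_nonneg)
  also have "\<dots> = (\<Sum>l\<le>m. weighted_norm \<rho> l f) + (\<Sum>l\<in>{m<..k}. weighted_norm \<rho> l f)"
    by (rule sum.union_disjoint) auto
  also have "\<dots> \<le> (\<Sum>l\<le>m. degree_norm l f) + C * generator_tail G k \<rho>"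
    using assms by (intro add_mono sum_mono weighted_norm_le tail_boundD)
  also have "\<dots> \<le> (\<Sum>l\<le>m. degree_norm l f) + C"
    using assms(2,5) by (simp add: mult_left_le)
  finally show ?thesis .
qed

lemma tail_bound_mult:
  assumes f: "tail_bound G C m f" "0 \<le> C" and g: "tail_bound G D m' g" "0 \<le> D"
  shows "\<exists>B\<ge>0. tail_bound G B (m + m') (f * g)"
proof -
  define Sf where "Sf = (\<Sum>l\<le>m. degree_norm l f) + C"
  define Sg where "Sg = (\<Sum>l\<le>m'. degree_norm l g) + D"
  have nonneg: "0 \<le> Sf" "0 \<le> Sg"
    using f(2) g(2) by (auto simp: Sf_def Sg_def sum_nonneg)
  have "tail_bound G (C * Sg + Sf * D) (m + m') (f * g)"
    unfolding tail_bound_def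
  proof (intro allI impI)
    fix k and \<rho> :: real
    assume \<rho>: "0 \<le> \<rho>" "\<rho> \<le> 1" "generator_tail G k \<rho> \<le> 1"
    let ?F = "\<lambda>i. weighted_norm \<rho> i f" and ?G = "\<lambda>j. weighted_norm \<rho> j g"
    let ?T = "generator_tail G k \<rho>"
    let ?A = "{m<..k} \<times> {..k}" and ?B = "{..k} \<times> {m'<..k}"
    let ?S = "SIGMA l:{m + m'<..k}. {..l}"
    have pos: "0 \<le> ?F i * ?G j" for i j
      using \<rho>(1) by (simp add: weighted_norm_nonneg)
    have "(\<Sum>l\<in>{m + m'<..k}. weighted_norm \<rho> l (f * g)) \<le>
        (\<Sum>l\<in>{m + m'<..k}. \<Sum>i\<le>l. ?F i * ?G (l - i))"
      using \<rho>(1) by (intro sum_mono weighted_norm_mult)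
    also have "\<dots> = (\<Sum>(l, i)\<in>?S. ?F i * ?G (l - i))"
      by (rule sum.Sigma) auto
    also have "\<dots> = (\<Sum>(i, j)\<in>(\<lambda>(l, i). (i, l - i)) ` ?S. ?F i * ?G j)"
      by (subst sum.reindex) (auto simp: inj_on_def case_prod_unfold)
    \<comment> \<open>In a product of degree above \<open>m + m'\<close>, one factor has degree above its own threshold.\<close>
    also have "\<dots> \<le> (\<Sum>(i, j)\<in>?A \<union> ?B. ?F i * ?G j)"
      using pos by (intro sum_mono2) auto
    also have "\<dots> \<le> (\<Sum>(i, j)\<in>?A. ?F i * ?G j) + (\<Sum>(i, j)\<in>?B. ?F i * ?G j)"
      using pos by (subst sum_Un) (auto intro!: sum_nonneg)
    also have "\<dots> = (\<Sum>i\<in>{m<..k}. ?F i) * (\<Sum>j\<le>k. ?G j) + (\<Sum>i\<le>k. ?F i) * (\<Sum>j\<in>{m'<..k}. ?G j)"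
      by (simp add: sum_product sum.cartesian_product)
    also have "\<dots> \<le> (C * ?T) * Sg + Sf * (D * ?T)"
      unfolding Sf_def Sg_def using f g \<rho> nonneg[unfolded Sf_def]
      by (intro add_mono mult_mono tail_boundD tail_bound_total)
         (auto intro!: sum_nonneg weighted_norm_nonneg mult_nonneg_nonneg generator_tail_nonneg)
    finally show "(\<Sum>l\<in>{m + m'<..k}. weighted_norm \<rho> l (f * g)) \<le> (C * Sg + Sf * D) * ?T"
      by (simp add: algebra_simps)
  qed
  then show ?thesis
    using f(2) g(2) nonneg by (intro exI [of _ "C * Sg + Sf * D"]) auto
qed

lemma tail_bound_generated_algebra:
  fixes f :: "(complex, 'n::finite) mfps"
  assumes "finite G" "f \<in> generated_algebra G"
  shows "\<exists>C\<ge>0. \<exists>m. tail_bound G C m f"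
  using assms(2)
proof induction
  case (const c)
  have "degree_norm l (mfps_const c :: (complex, 'n) mfps) = 0" if "0 < l" for l
    using that by (intro degree_norm_eq_0I) (auto simp: mfps_nth_const multi_degree_def)
  then have "tail_bound G 0 0 (mfps_const c)"
    by (auto simp: tail_bound_def weighted_norm_def intro!: sum_nonpos)
  then show ?case
    by (intro exI [of _ 0]) auto
next
  case (gen y)
  have "tail_bound G 1 1 y"
    unfolding tail_bound_def
  proof (intro allI impI)
    fix k :: nat and \<rho> :: real
    assume "0 \<le> \<rho>"
    have "{1<..k} = {2..k :: nat}"
      by auto
    moreover have "(\<Sum>l\<in>{2..k}. weighted_norm \<rho> l y) \<le> generator_tail G k \<rho>"
      unfolding generator_tail_def using gen assms(1) \<open>0 \<le> \<rho>\<close>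
      by (intro sum_mono member_le_sum) (auto simp: weighted_norm_nonneg)
    ultimately show "(\<Sum>l\<in>{1<..k}. weighted_norm \<rho> l y) \<le> 1 * generator_tail G k \<rho>"
      by simp
  qed
  then show ?case
    by (intro exI [of _ 1]) auto
next
  case (add f g)
  then obtain C m D m' where f: "tail_bound G C m f" "0 \<le> C" and g: "tail_bound G D m' g" "0 \<le> D"
    by auto
  have f': "tail_bound G C (max m m') f" and g': "tail_bound G D (max m m') g"
    using f g by (auto intro: tail_bound_mono)
  have "tail_bound G (C + D) (max m m') (f + g)"
    unfolding tail_bound_def
  proof (intro allI impI)
    fix k and \<rho> :: real
    assume \<rho>: "0 \<le> \<rho>" "\<rho> \<le> 1" "generator_tail G k \<rho> \<le> 1"
    have "(\<Sum>l\<in>{max m m'<..k}. weighted_norm \<rho> l (f + g)) \<le>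
        (\<Sum>l\<in>{max m m'<..k}. weighted_norm \<rho> l f) + (\<Sum>l\<in>{max m m'<..k}. weighted_norm \<rho> l g)"
      unfolding sum.distrib [symmetric] using \<rho>(1) by (intro sum_mono weighted_norm_add)
    also have "\<dots> \<le> C * generator_tail G k \<rho> + D * generator_tail G k \<rho>"
      using \<rho> by (intro add_mono tail_boundD [OF f'] tail_boundD [OF g'])
    finally show "(\<Sum>l\<in>{max m m'<..k}. weighted_norm \<rho> l (f + g)) \<le> (C + D) * generator_tail G k \<rho>"
      by (simp add: algebra_simps)
  qed
  then show ?case
    using f g by (intro exI [of _ "C + D"]) auto
next
  case (mult f g)
  then show ?case
    using tail_bound_mult by blast
qed

lemma tail_bound_uniform:
  assumes "finite G" "finite F" "F \<subseteq> generated_algebra G"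
  shows "\<exists>C\<ge>0. \<exists>m. \<forall>f\<in>F. tail_bound G C m f"
  using assms(2,3)
proof induction
  case (insert f F)
  then obtain C m where F: "C \<ge> 0" "\<forall>f\<in>F. tail_bound G C m f"
    by auto
  obtain D m' where f: "D \<ge> 0" "tail_bound G D m' f"
    using tail_bound_generated_algebra [OF assms(1)] insert.prems by blast
  show ?case
    using F f by (intro exI [of _ "max C D"] conjI exI [of _ "max m m'"])
      (auto intro: tail_bound_mono)
qed auto

lemma mfps_nth_Euler_operator:
  "(\<Sum>\<alpha>\<in>UNIV. mfps_var \<alpha> * mfps_pderiv \<alpha> f) $$ m =
    of_nat (multi_degree m) * (f $$ m :: 'a::comm_ring_1)"
proof -
  have "(mfps_var \<alpha> * mfps_pderiv \<alpha> f) $$ m = of_nat (m $ \<alpha>) * f $$ m" for \<alpha>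
    using multi_index_minus_axis [of m \<alpha>]
    by (simp add: mfps_nth_var_times mfps_pderiv_nth del: One_nat_def)
  then show ?thesis
    by (simp add: mfps_nth_sum multi_degree_def sum_distrib_right)
qed

lemma degree_norm_cong: "(\<And>m. multi_degree m = k \<Longrightarrow> f $$ m = g $$ m) \<Longrightarrow> degree_norm k f = degree_norm k g"
  by (simp add: degree_norm_def)

text \<open>The hypotheses say that \<open>W\<close> is the radial field \<open>\<Sum>\<^sub>\<alpha> t\<^sup>\<alpha> \<partial>\<^sub>\<alpha>\<close>
  up to terms of order two. The radial field multiplies the part of degree \<open>k\<close> by \<open>k\<close>, and
  the remainder involves derivatives of parts of lower degree only.\<close>

lemma degree_norm_le_vf_apply:
  fixes W :: "'n::finite vfield"
  assumes W0: "\<And>\<alpha>. W $ \<alpha> $$ 0 = 0"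
    and W1: "\<And>\<alpha> \<beta>. W $ \<alpha> $$ axis \<beta> 1 = (if \<alpha> = \<beta> then 1 else 0)"
  shows "real k * degree_norm k f \<le> degree_norm k (vf_apply W f) +
    (\<Sum>\<alpha>\<in>UNIV. \<Sum>l\<in>{2..k}. degree_norm l (W $ \<alpha>) * (real (k - l + 1) * degree_norm (k - l + 1) f))"
proof -
  define V where "V \<alpha> = W $ \<alpha> - mfps_var \<alpha>" for \<alpha>
  have V_low: "degree_norm l (V \<alpha>) = 0" if "l < 2" for l \<alpha>
  proof (rule degree_norm_eq_0I)
    fix m :: "nat^'n" assume m: "multi_degree m = l"
    consider "m = 0" | \<beta> where "m = axis \<beta> 1"
      using m \<open>l < 2\<close> multi_degree_1E [of m] by (auto simp: less_2_cases_iff multi_degree_eq_0)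
    then show "V \<alpha> $$ m = 0"
    proof cases
      case 1
      have "(0 :: nat^'n) \<noteq> axis \<alpha> 1"
        by (metis multi_degree_axis multi_degree_eq_0 zero_neq_one)
      then show ?thesis
        using 1 W0 by (simp add: V_def mfps_var_def)
    next
      case 2
      have "axis \<beta> (1 :: nat) = axis \<alpha> 1 \<longleftrightarrow> \<alpha> = \<beta>"
        by (auto simp: axis_eq_axis)
      then show ?thesis
        using 2 W1 by (simp add: V_def mfps_var_def del: One_nat_def)
    qed
  qed
  have V_high: "degree_norm l (V \<alpha>) = degree_norm l (W $ \<alpha>)" if "2 \<le> l" for l \<alpha>
    using that by (intro degree_norm_cong) (auto simp: V_def mfps_var_def)
  have "(\<Sum>\<alpha>\<in>UNIV. mfps_var \<alpha> * mfps_pderiv \<alpha> f) =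
      vf_apply W f - (\<Sum>\<alpha>\<in>UNIV. V \<alpha> * mfps_pderiv \<alpha> f)"
    by (simp add: V_def vf_apply_def algebra_simps sum.distrib sum_subtractf)
  then have "degree_norm k (\<Sum>\<alpha>\<in>UNIV. mfps_var \<alpha> * mfps_pderiv \<alpha> f) \<le>
      degree_norm k (vf_apply W f) + (\<Sum>\<alpha>\<in>UNIV. degree_norm k (V \<alpha> * mfps_pderiv \<alpha> f))"
    using degree_norm_sum [of k "\<lambda>\<alpha>. V \<alpha> * mfps_pderiv \<alpha> f" UNIV]
    by (metis (no_types, lifting) add_left_mono degree_norm_diff order_trans)
  moreover have "degree_norm k (\<Sum>\<alpha>\<in>UNIV. mfps_var \<alpha> * mfps_pderiv \<alpha> f) = real k * degree_norm k f"
    by (simp add: degree_norm_def mfps_nth_Euler_operator norm_mult sum_distrib_left)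
  moreover have "degree_norm k (V \<alpha> * mfps_pderiv \<alpha> f) \<le>
      (\<Sum>l\<in>{2..k}. degree_norm l (W $ \<alpha>) * (real (k - l + 1) * degree_norm (k - l + 1) f))" for \<alpha>
  proof -
    have "degree_norm k (V \<alpha> * mfps_pderiv \<alpha> f) \<le>
        (\<Sum>l\<le>k. degree_norm l (V \<alpha>) * degree_norm (k - l) (mfps_pderiv \<alpha> f))"
      by (rule degree_norm_mult)
    also have "\<dots> = (\<Sum>l\<in>{2..k}. degree_norm l (V \<alpha>) * degree_norm (k - l) (mfps_pderiv \<alpha> f))"
      using V_low by (intro sum.mono_neutral_right) auto
    also have "\<dots> \<le> (\<Sum>l\<in>{2..k}. degree_norm l (W $ \<alpha>) * (real (k - l + 1) * degree_norm (k - l + 1) f))"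
      by (intro sum_mono mult_mono degree_norm_pderiv) (auto simp: V_high)
    finally show ?thesis .
  qed
  ultimately show ?thesis
    using sum_mono [of UNIV "\<lambda>\<alpha>. degree_norm k (V \<alpha> * mfps_pderiv \<alpha> f)"] by (smt (verit, best))
qed

text \<open>Division of the preceding estimate by \<open>k\<close>. For \<open>l < k\<close> the factor \<open>k - l + 1\<close>
  caused by the derivative is absorbed by \<open>k\<close>, at the price of the factor \<open>1 / \<rho>\<close>. The
  summand \<open>l = k\<close> combines the top part of \<open>W\<close> with the linear part of \<open>f\<close>; it keeps
  the gain \<open>1 / M\<close>, without which it could not be controlled.\<close>

lemma weighted_norm_le_vf_apply:
  fixes W :: "'n::finite vfield"
  assumes W0: "\<And>\<alpha>. W $ \<alpha> $$ 0 = 0"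
    and W1: "\<And>\<alpha> \<beta>. W $ \<alpha> $$ axis \<beta> 1 = (if \<alpha> = \<beta> then 1 else 0)"
    and "0 < \<rho>" "0 < M" "M < k" "2 \<le> k"
  shows "weighted_norm \<rho> k f \<le> weighted_norm \<rho> k (vf_apply W f) / M +
    (\<Sum>\<alpha>\<in>UNIV. weighted_norm \<rho> k (W $ \<alpha>) * degree_norm 1 f / M +
      (\<Sum>l\<in>{2..<k}. weighted_norm \<rho> l (W $ \<alpha>) * weighted_norm \<rho> (k - l + 1) f) / \<rho>)"
proof -
  let ?N = "\<lambda>l f. weighted_norm \<rho> l f"
  have low: "x / k \<le> x / M" if "0 \<le> x" for x :: real
    using assms that by (intro divide_left_mono) auto
  have N: "0 \<le> ?N l f" for l and f :: "(complex, 'n) mfps"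
    using assms by (simp add: weighted_norm_nonneg)
  have "?N k f = (real k * degree_norm k f) * (\<rho> ^ k / k)"
    using assms by (simp add: weighted_norm_def)
  also have "\<dots> \<le> (degree_norm k (vf_apply W f) +
      (\<Sum>\<alpha>\<in>UNIV. \<Sum>l\<in>{2..k}. degree_norm l (W $ \<alpha>) * (real (k - l + 1) * degree_norm (k - l + 1) f)))
      * (\<rho> ^ k / k)"
    using assms by (intro mult_right_mono degree_norm_le_vf_apply) auto
  also have "\<dots> = ?N k (vf_apply W f) / k + (\<Sum>\<alpha>\<in>UNIV. \<Sum>l\<in>{2..k}.
      degree_norm l (W $ \<alpha>) * (real (k - l + 1) * degree_norm (k - l + 1) f) * (\<rho> ^ k / k))"
    unfolding weighted_norm_def by (simp only: distrib_right sum_distrib_right times_divide_eq_right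
          add_divide_distrib sum_divide_distrib)
  also have "\<dots> \<le> ?N k (vf_apply W f) / M + (\<Sum>\<alpha>\<in>UNIV. ?N k (W $ \<alpha>) * degree_norm 1 f / M +
      (\<Sum>l\<in>{2..<k}. ?N l (W $ \<alpha>) * ?N (k - l + 1) f) / \<rho>)"
  proof (intro add_mono sum_mono low N)
    fix \<alpha>
    have "{2..k} = insert k {2..<k}"
      using assms by auto
    then have "(\<Sum>l\<in>{2..k}. degree_norm l (W $ \<alpha>) * (real (k - l + 1) * degree_norm (k - l + 1) f) * (\<rho> ^ k / k))
        = ?N k (W $ \<alpha>) * degree_norm 1 f / k +
          (\<Sum>l\<in>{2..<k}. degree_norm l (W $ \<alpha>) * (real (k - l + 1) * degree_norm (k - l + 1) f) * (\<rho> ^ k / k))"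
      by (simp add: weighted_norm_def)
    also have "\<dots> \<le> ?N k (W $ \<alpha>) * degree_norm 1 f / M +
        (\<Sum>l\<in>{2..<k}. ?N l (W $ \<alpha>) * ?N (k - l + 1) f / \<rho>)"
    proof (intro add_mono sum_mono low mult_nonneg_nonneg N degree_norm_nonneg)
      fix l assume l: "l \<in> {2..<k}"
      then have "\<rho> ^ k * \<rho> = \<rho> ^ l * \<rho> ^ (k - l + 1)"
        by (simp flip: power_add)
      then have pow: "\<rho> ^ k = \<rho> ^ l * \<rho> ^ (k - l + 1) / \<rho>"
        using assms by (simp add: field_simps)
      have "real (k - l + 1) / k \<le> 1"
        using l by auto
      then have "degree_norm l (W $ \<alpha>) * degree_norm (k - l + 1) f * \<rho> ^ k * (real (k - l + 1) / k)
          \<le> degree_norm l (W $ \<alpha>) * degree_norm (k - l + 1) f * \<rho> ^ k"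
        using assms by (intro mult_left_le) auto
      also have "\<dots> = ?N l (W $ \<alpha>) * ?N (k - l + 1) f / \<rho>"
        unfolding pow by (simp add: weighted_norm_def)
      finally show "degree_norm l (W $ \<alpha>) * (real (k - l + 1) * degree_norm (k - l + 1) f) * (\<rho> ^ k / k)
          \<le> ?N l (W $ \<alpha>) * ?N (k - l + 1) f / \<rho>"
        by (simp add: ac_simps)
    qed
    finally show "(\<Sum>l\<in>{2..k}. degree_norm l (W $ \<alpha>) * (real (k - l + 1) * degree_norm (k - l + 1) f) * (\<rho> ^ k / k))
        \<le> ?N k (W $ \<alpha>) * degree_norm 1 f / M + (\<Sum>l\<in>{2..<k}. ?N l (W $ \<alpha>) * ?N (k - l + 1) f) / \<rho>"
      by (simp add: sum_divide_distrib)
  qed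
  finally show ?thesis .
qed

lemma sum_shifted_convolution_le:
  fixes u v :: "nat \<Rightarrow> real"
  assumes "\<And>i. 0 \<le> u i" "\<And>i. 0 \<le> v i"
  shows "(\<Sum>j\<in>{M<..k}. \<Sum>l\<in>{2..<j}. u l * v (j - l + 1)) \<le> (\<Sum>l\<in>{2..k}. u l) * (\<Sum>i\<in>{2..k}. v i)"
proof -
  let ?S = "SIGMA j:{M<..k}. {2..<j}"
  have "(\<Sum>j\<in>{M<..k}. \<Sum>l\<in>{2..<j}. u l * v (j - l + 1)) = (\<Sum>(j, l)\<in>?S. u l * v (j - l + 1))"
    by (rule sum.Sigma) auto
  also have "\<dots> = (\<Sum>(l, i)\<in>(\<lambda>(j, l). (l, j - l + 1)) ` ?S. u l * v i)"
    by (subst sum.reindex) (auto simp: inj_on_def case_prod_unfold)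
  also have "\<dots> \<le> (\<Sum>(l, i)\<in>{2..k} \<times> {2..k}. u l * v i)"
    using assms by (intro sum_mono2) auto
  also have "\<dots> = (\<Sum>l\<in>{2..k}. u l) * (\<Sum>i\<in>{2..k}. v i)"
    by (simp add: sum_product sum.cartesian_product)
  finally show ?thesis .
qed

text \<open>Write \<open>T\<close> for the tail of the generators. The parts of degree above \<open>M\<close> contribute to
  \<open>T\<close> at most a multiple of \<open>T / M\<close>, from the right-hand sides and from the top part of
  \<open>W\<close>, plus a multiple of \<open>(\<rho> + T / \<rho>) T\<close>, from the products of a part of \<open>W\<close> of
  degree at least \<open>2\<close> with a part of a generator of degree at least \<open>2\<close>. For large \<open>M\<close>
  and small \<open>\<rho>\<close> and \<open>T / \<rho>\<close> these are together at most \<open>T / 2\<close>, so \<open>T\<close> is bounded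
  by twice the contribution of the finitely many parts of degree at most \<open>M\<close>, which is
  \<open>O(\<rho>\<^sup>2)\<close>.\<close>

lemma generator_tail_bootstrap:
  fixes W :: "'n::finite vfield"
  assumes "finite G"
    and W0: "\<And>\<alpha>. W $ \<alpha> $$ 0 = 0"
    and W1: "\<And>\<alpha> \<beta>. W $ \<alpha> $$ axis \<beta> 1 = (if \<alpha> = \<beta> then 1 else 0)"
    and W: "\<And>\<alpha>. W $ \<alpha> \<in> generated_algebra G"
    and deriv: "\<And>y. y \<in> G \<Longrightarrow> vf_apply W y \<in> generated_algebra G"
  shows "\<exists>\<delta>>0. \<exists>\<rho>\<^sub>0>0. \<rho>\<^sub>0 \<le> 1 \<and> \<delta> * \<rho>\<^sub>0 \<le> 1 \<and> (\<forall>k \<rho>. 0 < \<rho> \<longrightarrow> \<rho> \<le> \<rho>\<^sub>0 \<longrightarrow>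
    generator_tail G k \<rho> \<le> \<delta> * \<rho> \<longrightarrow> generator_tail G k \<rho> \<le> \<delta> / 2 * \<rho>)"
proof -
  have "finite (range (($) W) \<union> vf_apply W ` G)" "range (($) W) \<union> vf_apply W ` G \<subseteq> generated_algebra G"
    using assms by auto
  from tail_bound_uniform [OF assms(1) this]
  obtain C m where C: "0 \<le> C"
    and bound: "\<forall>f\<in>range (($) W) \<union> vf_apply W ` G. tail_bound G C m f"
    by blast
  have bound_W: "tail_bound G C m (W $ \<alpha>)" for \<alpha>
    using bound by blast
  have bound_y: "tail_bound G C m (vf_apply W y)" if "y \<in> G" for y
    using bound that by blast
  define B where "B = (\<Sum>\<alpha>\<in>UNIV. \<Sum>l\<le>m. degree_norm l (W $ \<alpha>))"
  define a where "a = (\<Sum>y\<in>G. degree_norm 1 y)"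
  define n where "n = real CARD('n)"
  define g where "g = real (card G)"
  have nonneg: "0 \<le> B" "0 \<le> a" "0 \<le> g" "0 < n"
    by (auto simp: B_def a_def g_def n_def sum_nonneg)
  define M where "M = m + 2 + nat \<lceil>4 * (g * C + n * C * a)\<rceil>"
  have M: "m \<le> M" "0 < M" "2 \<le> M" "4 * (g * C + n * C * a) \<le> M"
    unfolding M_def by linarith+
  define L where "L = (\<Sum>j\<le>M. \<Sum>y\<in>G. degree_norm j y)"
  have L: "0 \<le> L"
    by (simp add: L_def sum_nonneg)
  define \<delta> where "\<delta> = 1 / (8 * n * C + 1)"
  have \<delta>: "0 < \<delta>" "\<delta> \<le> 1" "n * C * \<delta> \<le> 1 / 8"
    using C nonneg by (auto simp: \<delta>_def field_simps add_pos_nonneg)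
  \<comment> \<open>Chosen to make \<open>n * B * \<rho>\<^sub>0\<close> at most \<open>1 / 8\<close> and \<open>2 * L * \<rho>\<^sub>0\<close> at most \<open>\<delta> / 2\<close>.\<close>
  define D where "D = 8 * (n * B) + 4 * (L / \<delta>) + 1"
  define \<rho>\<^sub>0 where "\<rho>\<^sub>0 = 1 / D"
  have den: "0 \<le> n * B" "0 \<le> L / \<delta>"
    using nonneg \<delta> L by auto
  then have D: "8 * (n * B) \<le> D" "4 * (L / \<delta>) \<le> D" "1 \<le> D"
    by (auto simp: D_def)
  then have \<rho>\<^sub>0: "0 < \<rho>\<^sub>0" "\<rho>\<^sub>0 \<le> 1"
    by (auto simp: \<rho>\<^sub>0_def)
  have "x * \<rho>\<^sub>0 \<le> 1" if "x \<le> D" for x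
    using that D(3) by (simp add: \<rho>\<^sub>0_def divide_le_eq)
  then have "8 * (n * B) * \<rho>\<^sub>0 \<le> 1" "4 * (L / \<delta>) * \<rho>\<^sub>0 \<le> 1"
    using D by blast+
  then have \<rho>\<^sub>0': "n * B * \<rho>\<^sub>0 \<le> 1 / 8" "2 * L * \<rho>\<^sub>0 \<le> \<delta> / 2"
    using \<delta>(1) by (auto simp: field_simps)
  have "\<delta> * \<rho>\<^sub>0 \<le> 1"
    using \<delta> \<rho>\<^sub>0 by (simp add: mult_le_one)
  moreover have "generator_tail G k \<rho> \<le> \<delta> / 2 * \<rho>"
    if \<rho>: "0 < \<rho>" "\<rho> \<le> \<rho>\<^sub>0" and tail: "generator_tail G k \<rho> \<le> \<delta> * \<rho>" for k \<rho>
  proof -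
    let ?N = "\<lambda>l f. weighted_norm \<rho> l f"
    define T where "T = generator_tail G k \<rho>"
    define v where "v j = (\<Sum>y\<in>G. ?N j y)" for j
    have \<rho>1: "0 \<le> \<rho>" "\<rho> \<le> 1"
      using \<rho> \<rho>\<^sub>0 by auto
    have N: "0 \<le> ?N l f" for l and f :: "(complex, 'n) mfps"
      using \<rho>1 by (simp add: weighted_norm_nonneg)
    have v: "0 \<le> v j" for j
      by (simp add: v_def sum_nonneg N)
    have T0: "0 \<le> T"
      using \<rho>1 by (simp add: T_def generator_tail_nonneg)
    have T1: "generator_tail G k \<rho> \<le> 1"
      using tail \<delta>(1) \<rho> \<open>\<delta> * \<rho>\<^sub>0 \<le> 1\<close> by (smt (verit) mult_left_mono)
    have T_eq: "T = (\<Sum>j\<in>{2..k}. v j)"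
      by (simp add: T_def generator_tail_def v_def)
    have W_tail: "(\<Sum>j\<in>{M<..k}. ?N j (W $ \<alpha>)) \<le> C * T" for \<alpha>
      using tail_boundD [OF tail_bound_mono [OF bound_W order_refl M(1)] \<rho>1 T1] by (simp add: T_def)
    have W_sum: "(\<Sum>l\<in>{2..k}. ?N l (W $ \<alpha>)) \<le> B * \<rho>\<^sup>2 + C * T" for \<alpha>
    proof -
      have "(\<Sum>l\<in>{2..k}. ?N l (W $ \<alpha>)) \<le> (\<Sum>l\<in>{2..m} \<union> {m<..k}. ?N l (W $ \<alpha>))"
        by (intro sum_mono2) (auto simp: N)
      also have "\<dots> = (\<Sum>l\<in>{2..m}. ?N l (W $ \<alpha>)) + (\<Sum>l\<in>{m<..k}. ?N l (W $ \<alpha>))"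
        by (rule sum.union_disjoint) auto
      also have "\<dots> \<le> (\<Sum>l\<in>{2..m}. degree_norm l (W $ \<alpha>) * \<rho>\<^sup>2) + C * T"
        using tail_boundD [OF bound_W \<rho>1 T1] \<rho>1
        by (intro add_mono sum_mono) (auto simp: weighted_norm_def T_def intro!: mult_left_mono power_decreasing)
      also have "(\<Sum>l\<in>{2..m}. degree_norm l (W $ \<alpha>) * \<rho>\<^sup>2) \<le> (\<Sum>l\<le>m. degree_norm l (W $ \<alpha>)) * \<rho>\<^sup>2"
        unfolding sum_distrib_right by (intro sum_mono2) auto
      also have "\<dots> \<le> B * \<rho>\<^sup>2"
        unfolding B_def by (intro mult_right_mono member_le_sum) (auto intro: sum_nonneg)
      finally show ?thesis
        by simp
    qed
    have step: "v j \<le> (\<Sum>y\<in>G. ?N j (vf_apply W y)) / M +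
        (\<Sum>\<alpha>\<in>UNIV. ?N j (W $ \<alpha>) * a / M + (\<Sum>l\<in>{2..<j}. ?N l (W $ \<alpha>) * v (j - l + 1)) / \<rho>)"
      if "j \<in> {M<..k}" for j
    proof -
      have inner: "(\<Sum>y\<in>G. ?N j (W $ \<alpha>) * degree_norm 1 y / M +
          (\<Sum>l\<in>{2..<j}. ?N l (W $ \<alpha>) * ?N (j - l + 1) y) / \<rho>) =
          ?N j (W $ \<alpha>) * a / M + (\<Sum>l\<in>{2..<j}. ?N l (W $ \<alpha>) * v (j - l + 1)) / \<rho>" for \<alpha>
        unfolding a_def v_def
        by (simp add: sum.distrib sum_distrib_left sum_divide_distrib sum.swap [of _ G])
      have "v j \<le> (\<Sum>y\<in>G. ?N j (vf_apply W y) / M + (\<Sum>\<alpha>\<in>UNIV. ?N j (W $ \<alpha>) * degree_norm 1 y / M +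
          (\<Sum>l\<in>{2..<j}. ?N l (W $ \<alpha>) * ?N (j - l + 1) y) / \<rho>))"
        unfolding v_def using that \<rho> M by (intro sum_mono weighted_norm_le_vf_apply W0 W1) auto
      also have "\<dots> = (\<Sum>y\<in>G. ?N j (vf_apply W y)) / M +
          (\<Sum>\<alpha>\<in>UNIV. \<Sum>y\<in>G. ?N j (W $ \<alpha>) * degree_norm 1 y / M +
          (\<Sum>l\<in>{2..<j}. ?N l (W $ \<alpha>) * ?N (j - l + 1) y) / \<rho>)"
        by (simp add: sum.distrib sum_divide_distrib sum.swap [of _ UNIV G])
      finally show ?thesis
        unfolding inner .
    qed
    have "(\<Sum>j\<in>{M<..k}. v j) \<le> (\<Sum>j\<in>{M<..k}. (\<Sum>y\<in>G. ?N j (vf_apply W y)) / M +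
        (\<Sum>\<alpha>\<in>UNIV. ?N j (W $ \<alpha>) * a / M + (\<Sum>l\<in>{2..<j}. ?N l (W $ \<alpha>) * v (j - l + 1)) / \<rho>))"
      by (rule sum_mono [OF step])
    also have "\<dots> = (\<Sum>y\<in>G. \<Sum>j\<in>{M<..k}. ?N j (vf_apply W y)) / M +
        (\<Sum>\<alpha>\<in>UNIV. (\<Sum>j\<in>{M<..k}. ?N j (W $ \<alpha>)) * a / M +
          (\<Sum>j\<in>{M<..k}. \<Sum>l\<in>{2..<j}. ?N l (W $ \<alpha>) * v (j - l + 1)) / \<rho>)"
      by (simp add: sum.distrib sum_divide_distrib sum_distrib_right sum.swap [of _ _ "{M<..k}"])
    also have "\<dots> \<le> (\<Sum>y\<in>G. C * T) / M + (\<Sum>\<alpha>\<in>(UNIV :: 'n set). (C * T) * a / M + ((B * \<rho>\<^sup>2 + C * T) * T) / \<rho>)"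
    proof (intro add_mono sum_mono divide_right_mono mult_right_mono W_tail)
      show "(\<Sum>j\<in>{M<..k}. ?N j (vf_apply W y)) \<le> C * T" if "y \<in> G" for y
        using tail_boundD [OF tail_bound_mono [OF bound_y [OF that] order_refl M(1)] \<rho>1 T1]
        by (simp add: T_def)
      show "(\<Sum>j\<in>{M<..k}. \<Sum>l\<in>{2..<j}. ?N l (W $ \<alpha>) * v (j - l + 1)) \<le> (B * \<rho>\<^sup>2 + C * T) * T" for \<alpha>
        using sum_shifted_convolution_le [of "\<lambda>l. ?N l (W $ \<alpha>)" v M k] mult_right_mono [OF W_sum T0, of \<alpha>]
        by (simp add: N v T_eq)
    qed (use nonneg \<rho>1 in auto)
    also have "\<dots> = (g * C + n * C * a) / M * T + (n * B * \<rho> + n * C * (T / \<rho>)) * T"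
      using \<rho>(1) by (simp add: g_def n_def field_simps power2_eq_square flip: add_divide_distrib)
    also have "\<dots> \<le> (1 / 4) * T + (1 / 8 + 1 / 8) * T"
    proof (intro add_mono mult_right_mono T0)
      show "(g * C + n * C * a) / real M \<le> 1 / 4"
        using M by (simp add: field_simps)
      show "n * B * \<rho> \<le> 1 / 8"
        using \<rho>\<^sub>0'(1) \<rho>(2) den(1) by (smt (verit) mult_left_mono)
      have "n * C * (T / \<rho>) \<le> n * C * \<delta>"
        using tail \<rho>(1) C nonneg by (intro mult_left_mono) (auto simp: T_def field_simps)
      then show "n * C * (T / \<rho>) \<le> 1 / 8"
        using \<delta>(3) by linarith
    qed
    finally have high: "(\<Sum>j\<in>{M<..k}. v j) \<le> T / 2"
      by simp
    have "(\<Sum>j\<in>{2..M}. v j) \<le> (\<Sum>j\<in>{2..M}. (\<Sum>y\<in>G. degree_norm j y) * \<rho>\<^sup>2)"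
      unfolding v_def sum_distrib_right weighted_norm_def using \<rho>1
      by (intro sum_mono mult_left_mono power_decreasing) auto
    also have "\<dots> \<le> L * \<rho>\<^sup>2"
      unfolding L_def sum_distrib_right by (intro sum_mono2) (auto intro!: sum_nonneg)
    finally have low: "(\<Sum>j\<in>{2..M}. v j) \<le> L * \<rho>\<^sup>2" .
    have "T \<le> (\<Sum>j\<in>{2..M} \<union> {M<..k}. v j)"
      unfolding T_eq by (intro sum_mono2) (auto simp: v)
    also have "\<dots> = (\<Sum>j\<in>{2..M}. v j) + (\<Sum>j\<in>{M<..k}. v j)"
      by (rule sum.union_disjoint) auto
    finally have "T \<le> 2 * L * \<rho> * \<rho>"
      using low high by (simp add: power2_eq_square)
    also have "\<dots> \<le> \<delta> / 2 * \<rho>"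
      using \<rho>\<^sub>0'(2) \<rho> L by (intro mult_right_mono) (smt (verit) mult_left_mono)+
    finally show ?thesis
      by (simp add: T_def)
  qed
  ultimately show ?thesis
    using \<delta> \<rho>\<^sub>0 by blast
qed

text \<open>The series in \<open>G\<close> solve formally a system \<open>W y = p(y)\<close> with polynomial right-hand
  sides, where \<open>W\<close> is itself polynomial in the unknowns and is radial to first order: a system of
  Briot--Bouquet type. Since the radial field divides the part of degree \<open>k\<close> by \<open>k\<close> when it
  is inverted, it dominates everything else in high degrees, and low degrees are finite in number.
  For fixed \<open>k\<close> the quotient of the tail by \<open>\<rho>\<close> is a polynomial in \<open>\<rho>\<close> that
  vanishes at \<open>0\<close>. By the previous lemma its value is never in the gap between \<open>\<delta> / 2\<close> and
  \<open>\<delta>\<close>, so by continuity it stays below \<open>\<delta>\<close> up to a radius that does not depend on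
  \<open>k\<close>.\<close>

theorem Euler_type_system_convergent:
  fixes W :: "'n::finite vfield"
  assumes "finite G"
    and W0: "\<And>\<alpha>. W $ \<alpha> $$ 0 = 0"
    and W1: "\<And>\<alpha> \<beta>. W $ \<alpha> $$ axis \<beta> 1 = (if \<alpha> = \<beta> then 1 else 0)"
    and W: "\<And>\<alpha>. W $ \<alpha> \<in> generated_algebra G"
    and deriv: "\<And>y. y \<in> G \<Longrightarrow> vf_apply W y \<in> generated_algebra G"
  shows "\<exists>\<rho>>0. \<forall>f\<in>generated_algebra G. \<exists>C. \<forall>k. (\<Sum>l\<le>k. weighted_norm \<rho> l f) \<le> C"
proof -
  obtain \<delta> \<rho>\<^sub>0 where \<delta>: "0 < \<delta>" and \<rho>\<^sub>0: "0 < \<rho>\<^sub>0" "\<rho>\<^sub>0 \<le> 1" "\<delta> * \<rho>\<^sub>0 \<le> 1"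
    and boot: "\<And>k \<rho>. 0 < \<rho> \<Longrightarrow> \<rho> \<le> \<rho>\<^sub>0 \<Longrightarrow> generator_tail G k \<rho> \<le> \<delta> * \<rho> \<Longrightarrow>
      generator_tail G k \<rho> \<le> \<delta> / 2 * \<rho>"
    using generator_tail_bootstrap [OF assms] by metis
  have tail: "generator_tail G k \<rho>\<^sub>0 \<le> \<delta> * \<rho>\<^sub>0" for k
  proof (rule ccontr)
    assume large: "\<not> generator_tail G k \<rho>\<^sub>0 \<le> \<delta> * \<rho>\<^sub>0"
    define \<tau> where "\<tau> \<rho> = (\<Sum>j\<in>{2..k}. \<Sum>y\<in>G. degree_norm j y * \<rho> ^ (j - 1))" for \<rho>
    have T: "generator_tail G k \<rho> = \<tau> \<rho> * \<rho>" for \<rho>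
      unfolding generator_tail_def \<tau>_def sum_distrib_right
    proof (intro sum.cong refl)
      fix j and y :: "(complex, 'n) mfps" assume "j \<in> {2..k}"
      then have "\<rho> ^ j = \<rho> ^ (j - 1) * \<rho>"
        by (metis atLeastAtMost_iff mult.commute not_numeral_le_zero power_minus_mult zero_less_iff_neq_zero)
      then show "weighted_norm \<rho> j y = degree_norm j y * \<rho> ^ (j - 1) * \<rho>"
        by (simp add: weighted_norm_def)
    qed
    have "\<tau> 0 = 0"
      by (auto simp: \<tau>_def intro!: sum.neutral)
    moreover have "\<delta> \<le> \<tau> \<rho>\<^sub>0"
      using large T \<rho>\<^sub>0 by (simp add: mult_less_cancel_right)
    moreover have "continuous_on {0..\<rho>\<^sub>0} \<tau>"
      unfolding \<tau>_def by (intro continuous_intros)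
    ultimately obtain \<rho> where \<rho>: "0 \<le> \<rho>" "\<rho> \<le> \<rho>\<^sub>0" "\<tau> \<rho> = \<delta>"
      using IVT' [of \<tau> 0 \<delta> \<rho>\<^sub>0] \<delta> \<rho>\<^sub>0 by auto
    with \<open>\<tau> 0 = 0\<close> \<delta> have "0 < \<rho>"
      by (cases "\<rho> = 0") auto
    then have "\<delta> * \<rho> \<le> \<delta> / 2 * \<rho>"
      using boot [of \<rho> k] \<rho> by (simp add: T)
    then show False
      using \<open>0 < \<rho>\<close> \<delta> by simp
  qed
  have "\<exists>C. \<forall>k. (\<Sum>l\<le>k. weighted_norm \<rho>\<^sub>0 l f) \<le> C" if f: "f \<in> generated_algebra G" for f
  proof -
    obtain C m where "0 \<le> C" "tail_bound G C m f"
      using tail_bound_generated_algebra [OF assms(1) f] by blast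
    moreover have "generator_tail G k \<rho>\<^sub>0 \<le> 1" for k
      using tail [of k] \<rho>\<^sub>0(3) by simp
    ultimately show ?thesis
      using tail_bound_total \<rho>\<^sub>0 by (metis less_imp_le)
  qed
  then show ?thesis
    using \<rho>\<^sub>0(1) by blast
qed


section \<open>Polynomials and matrices\<close>

text \<open>Hermite interpolation. To pass from \<open>S\<close> to \<open>insert a S\<close>, the multiple
  \<open>s\<^sup>2 l\<close> of the square of \<open>s = \<Prod>\<^sub>c\<^sub>\<in>\<^sub>S (x - c)\<close> is added; it does not change the
  conditions on \<open>S\<close>, and the linear polynomial \<open>l\<close> is adjusted to the two conditions at
  \<open>a\<close>.\<close>

lemma poly_simple_zeros_unit_slope:
  fixes S :: "'a::field set"
  assumes "finite S"
  shows "\<exists>h. \<forall>c\<in>S. poly h c = 0 \<and> poly (pderiv h) c = 1"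
  using assms
proof induction
  case (insert a S)
  then obtain h where h: "\<forall>c\<in>S. poly h c = 0 \<and> poly (pderiv h) c = 1"
    by blast
  define s where "s = (\<Prod>c\<in>S. [:- c, 1:])"
  have s_zero: "poly s c = 0" if "c \<in> S" for c
    using that insert.hyps(1) by (auto simp: s_def poly_prod)
  have s_a: "poly s a \<noteq> 0"
    using insert.hyps by (auto simp: s_def poly_prod)
  define v where "v = - poly h a / poly (s * s) a"
  define w where "w = (1 - poly (pderiv h) a - poly (pderiv (s * s)) a * v) / poly (s * s) a"
  define l where "l = [:v - w * a, w:]"
  have l: "poly l a = v" "poly (pderiv l) a = w"
    by (simp_all add: l_def pderiv_pCons)
  define k where "k = h + s * s * l"
  have "poly k c = 0 \<and> poly (pderiv k) c = 1" if "c \<in> S" for c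
    using h s_zero that by (simp add: k_def pderiv_add pderiv_mult)
  moreover have "poly k a = 0"
    using s_a by (simp add: k_def l v_def)
  moreover have "poly (pderiv k) a = poly (pderiv h) a + poly (pderiv (s * s)) a * v + poly (s * s) a * w"
    by (simp add: k_def l pderiv_add pderiv_mult algebra_simps)
  then have "poly (pderiv k) a = 1"
    using s_a by (simp add: w_def)
  ultimately show ?case
    by blast
qed auto

lemma poly_pderiv_eq_sum:
  fixes h :: "'a::{comm_ring_1, ring_no_zero_divisors} poly"
  shows "poly (pderiv h) x = (\<Sum>k\<le>degree h. coeff h k * (of_nat k * x ^ (k - 1)))"
proof -
  have "pderiv h = (\<Sum>k\<le>degree h. pderiv (monom (coeff h k) k))"
    using higher_pderiv_sum [of 1 "\<lambda>k. monom (coeff h k) k" "{..degree h}"]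
    by (simp add: poly_as_sum_of_monoms)
  then show ?thesis
    by (simp add: pderiv_monom poly_sum poly_monom mult_ac)
qed

lemma matrix_inv_inverse:
  assumes "invertible A"
  shows "A ** matrix_inv A = mat 1" "matrix_inv A ** A = mat 1"
proof -
  have "A ** matrix_inv A = mat 1 \<and> matrix_inv A ** A = mat 1"
    using assms unfolding invertible_def matrix_inv_def by (rule someI_ex)
  then show "A ** matrix_inv A = mat 1" "matrix_inv A ** A = mat 1"
    by auto
qed

lemma invertible_if_left_kernel_trivial:
  fixes A :: "'a::field^'n^'n"
  assumes "\<And>x. x v* A = 0 \<Longrightarrow> x = 0"
  shows "invertible A"
  using assms matrix_left_invertible_ker [of "transpose A"]
  by (simp add: left_invertible_transpose invertible_right_inverse)

definition diagonal_matrix :: "('n::finite \<Rightarrow> 'a::zero) \<Rightarrow> 'a^'n^'n"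
  where "diagonal_matrix d = (\<chi> i j. if i = j then d i else 0)"

lemma diagonal_matrix_times:
  "(diagonal_matrix d ** A) $ i $ j = d i * (A $ i $ j :: 'a::semiring_1)"
  "(A ** diagonal_matrix d) $ i $ j = A $ i $ j * (d j :: 'a::semiring_1)"
  by (simp_all add: diagonal_matrix_def matrix_matrix_mult_def if_distrib if_distribR cong: if_cong)


section \<open>Flat F-manifolds with Euler field\<close>

text \<open>The product \<open>\<Delta>\<^sub>\<alpha> \<circ> \<Delta>\<^sub>\<beta> = \<Sum>\<^sub>\<gamma> c \<alpha> \<beta> \<gamma> \<Delta>\<^sub>\<gamma>\<close>
  is associative with flat unit \<open>\<Delta>\<^sub>u\<close>. The multiplications by the
  \<open>\<Delta>\<^sub>\<alpha>\<close> are the partial derivatives of a matrix, which is the condition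
  \<open>potential\<close>, and \<open>L\<^sub>E c = c\<close> for a field \<open>E\<close> with
  constant derivatives. Semisimplicity at the origin is given by the \<open>n\<close> characters of the algebra there: \<open>\<phi> $ \<alpha> $ i\<close> is the value of the
  \<open>i\<close>-th one at \<open>\<Delta>\<^sub>\<alpha>\<close>.\<close>

locale semisimple_flat_F_manifold =
  fixes c :: "'n::finite \<Rightarrow> 'n \<Rightarrow> 'n \<Rightarrow> (complex, 'n) mfps"
    and u :: 'n
    and E :: "'n vfield"
    and \<phi> :: "complex^'n^'n"
  assumes unit: "c u \<beta> \<gamma> = (if \<beta> = \<gamma> then 1 else 0)"
    and assoc: "(\<Sum>\<delta>\<in>UNIV. c \<alpha> \<beta> \<delta> * c \<delta> \<epsilon> \<kappa>) = (\<Sum>\<delta>\<in>UNIV. c \<beta> \<epsilon> \<delta> * c \<alpha> \<delta> \<kappa>)"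
    and potential: "mfps_pderiv \<delta> (c \<alpha> \<beta> \<gamma>) = mfps_pderiv \<alpha> (c \<delta> \<beta> \<gamma>)"
    and Euler: "vf_apply E (c \<alpha> \<beta> \<gamma>) = c \<alpha> \<beta> \<gamma> + (\<Sum>\<delta>\<in>UNIV. c \<alpha> \<beta> \<delta> * mfps_pderiv \<delta> (E $ \<gamma>))
      - (\<Sum>\<delta>\<in>UNIV. mfps_pderiv \<alpha> (E $ \<delta>) * c \<delta> \<beta> \<gamma>) - (\<Sum>\<delta>\<in>UNIV. mfps_pderiv \<beta> (E $ \<delta>) * c \<alpha> \<delta> \<gamma>)"
    and affine: "mfps_pderiv \<alpha> (mfps_pderiv \<beta> (E $ \<gamma>)) = 0"
    and characters: "\<phi> $ \<alpha> $ i * \<phi> $ \<beta> $ i = (\<Sum>\<gamma>\<in>UNIV. c \<alpha> \<beta> \<gamma> $$ 0 * \<phi> $ \<gamma> $ i)"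
    and invertible_characters: "invertible \<phi>"
begin

text \<open>Endomorphisms are matrices that act on row vectors: \<open>\<Delta>\<^sub>\<beta>\<close> goes to
  \<open>\<Sum>\<^sub>\<gamma> U \<beta> \<gamma> \<Delta>\<^sub>\<gamma>\<close>. This \<open>U\<close> is the multiplication by
  \<open>E\<close>.\<close>

definition U :: "'n \<Rightarrow> 'n \<Rightarrow> (complex, 'n) mfps"
  where "U \<beta> \<gamma> = (\<Sum>\<alpha>\<in>UNIV. E $ \<alpha> * c \<alpha> \<beta> \<gamma>)"

fun U_power :: "nat \<Rightarrow> 'n \<Rightarrow> 'n \<Rightarrow> (complex, 'n) mfps"
  where
    "U_power 0 \<beta> \<gamma> = (if \<beta> = \<gamma> then 1 else 0)"
  | "U_power (Suc k) \<beta> \<gamma> = (\<Sum>\<delta>\<in>UNIV. U_power k \<beta> \<delta> * U \<delta> \<gamma>)"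

text \<open>The derivative of \<open>U\<close> in direction \<open>\<alpha>\<close> is \<open>C\<^sub>\<alpha> + [C\<^sub>\<alpha>, \<nabla>E]\<close>,
  where \<open>C\<^sub>\<alpha>\<close> is the multiplication by \<open>\<Delta>\<^sub>\<alpha>\<close>. No derivative of \<open>c\<close>
  is left, because potentiality turns \<open>E\<^sup>\<delta> \<partial>\<^sub>\<alpha> c\<close> into the derivative of \<open>c\<close> along
  \<open>E\<close>, which the Euler condition eliminates.\<close>

lemma pderiv_U:
  "mfps_pderiv \<alpha> (U \<beta> \<gamma>) = c \<alpha> \<beta> \<gamma> + (\<Sum>\<delta>\<in>UNIV. c \<alpha> \<beta> \<delta> * mfps_pderiv \<delta> (E $ \<gamma>))
    - (\<Sum>\<delta>\<in>UNIV. mfps_pderiv \<beta> (E $ \<delta>) * c \<alpha> \<delta> \<gamma>)"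
proof -
  have "mfps_pderiv \<alpha> (U \<beta> \<gamma>) =
      (\<Sum>\<delta>\<in>UNIV. mfps_pderiv \<alpha> (E $ \<delta>) * c \<delta> \<beta> \<gamma>) + (\<Sum>\<delta>\<in>UNIV. E $ \<delta> * mfps_pderiv \<alpha> (c \<delta> \<beta> \<gamma>))"
    by (simp add: U_def mfps_pderiv_sum mfps_pderiv_mult sum.distrib)
  also have "(\<Sum>\<delta>\<in>UNIV. E $ \<delta> * mfps_pderiv \<alpha> (c \<delta> \<beta> \<gamma>)) = vf_apply E (c \<alpha> \<beta> \<gamma>)"
    unfolding vf_apply_def using potential [of \<alpha>] by simp
  finally show ?thesis
    by (simp add: Euler)
qed

text \<open>By associativity, the powers of \<open>U\<close> are the multiplications by the powers of \<open>E\<close>; the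
  vector to multiply by is recovered by applying the matrix to the unit.\<close>

lemma U_power_eq_multiplication: "U_power k \<beta> \<gamma> = (\<Sum>\<alpha>\<in>UNIV. U_power k u \<alpha> * c \<alpha> \<beta> \<gamma>)"
proof (induction k arbitrary: \<gamma>)
  case 0
  show ?case
    by (simp add: unit mult_delta_left)
next
  case (Suc k)
  have "U_power (Suc k) \<beta> \<gamma> = (\<Sum>\<delta>\<in>UNIV. (\<Sum>\<alpha>\<in>UNIV. U_power k u \<alpha> * c \<alpha> \<beta> \<delta>) * U \<delta> \<gamma>)"
    by (simp only: U_power.simps Suc.IH [symmetric])
  also have "\<dots> = (\<Sum>\<delta>\<in>UNIV. \<Sum>\<alpha>\<in>UNIV. \<Sum>\<epsilon>\<in>UNIV. U_power k u \<alpha> * E $ \<epsilon> * (c \<alpha> \<beta> \<delta> * c \<epsilon> \<delta> \<gamma>))"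
    unfolding U_def sum_product by (simp add: ac_simps)
  also have "\<dots> = (\<Sum>\<alpha>\<in>UNIV. \<Sum>\<epsilon>\<in>UNIV. \<Sum>\<delta>\<in>UNIV. U_power k u \<alpha> * E $ \<epsilon> * (c \<alpha> \<beta> \<delta> * c \<epsilon> \<delta> \<gamma>))"
    by (rule trans [OF sum.swap], rule sum.cong [OF refl], rule sum.swap)
  also have "\<dots> = (\<Sum>\<alpha>\<in>UNIV. \<Sum>\<epsilon>\<in>UNIV. \<Sum>\<delta>\<in>UNIV. U_power k u \<alpha> * E $ \<epsilon> * (c \<epsilon> \<alpha> \<delta> * c \<delta> \<beta> \<gamma>))"
    unfolding sum_distrib_left [symmetric] by (simp add: assoc)
  also have "\<dots> = (\<Sum>\<delta>\<in>UNIV. \<Sum>\<alpha>\<in>UNIV. \<Sum>\<epsilon>\<in>UNIV. U_power k u \<alpha> * E $ \<epsilon> * (c \<epsilon> \<alpha> \<delta> * c \<delta> \<beta> \<gamma>))"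
    by (rule sym, rule trans [OF sum.swap], rule sum.cong [OF refl], rule sum.swap)
  also have "\<dots> = (\<Sum>\<delta>\<in>UNIV. U_power (Suc k) u \<delta> * c \<delta> \<beta> \<gamma>)"
    by (simp add: U_def sum_distrib_left sum_distrib_right ac_simps)
  finally show ?case .
qed

text \<open>\<open>h(U)\<close> as a matrix, and the vector field \<open>h(E)\<close>, the power being taken with respect to
  the product.\<close>

definition spectral_function :: "complex poly \<Rightarrow> 'n \<Rightarrow> 'n \<Rightarrow> (complex, 'n) mfps"
  where "spectral_function h \<beta> \<gamma> = (\<Sum>k\<le>degree h. mfps_const (coeff h k) * U_power k \<beta> \<gamma>)"

definition spectral_field :: "complex poly \<Rightarrow> 'n vfield"
  where "spectral_field h = (\<chi> \<gamma>. spectral_function h u \<gamma>)"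

lemma spectral_function_eq_multiplication:
  "spectral_function h \<beta> \<gamma> = (\<Sum>\<alpha>\<in>UNIV. spectral_field h $ \<alpha> * c \<alpha> \<beta> \<gamma>)"
proof -
  have "spectral_function h \<beta> \<gamma> =
      (\<Sum>k\<le>degree h. mfps_const (coeff h k) * (\<Sum>\<alpha>\<in>UNIV. U_power k u \<alpha> * c \<alpha> \<beta> \<gamma>))"
    by (simp only: spectral_function_def U_power_eq_multiplication [symmetric])
  also have "\<dots> = (\<Sum>\<alpha>\<in>UNIV. spectral_field h $ \<alpha> * c \<alpha> \<beta> \<gamma>)"
    by (simp add: spectral_field_def spectral_function_def sum_distrib_left sum_distrib_right
          sum.swap [of _ UNIV] mult.assoc)
  finally show ?thesis .
qed

text \<open>The entries of \<open>U\<close> and of \<open>\<nabla>E\<close> are included so that the right-hand side of the formula for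
  the derivatives of \<open>U\<close> is a polynomial in the generators.\<close>

definition generators :: "(complex, 'n) mfps set"
  where "generators = range (\<lambda>(\<alpha>, \<beta>, \<gamma>). c \<alpha> \<beta> \<gamma>) \<union> range (\<lambda>(\<beta>, \<gamma>). U \<beta> \<gamma>)
    \<union> range (\<lambda>(\<alpha>, \<gamma>). mfps_pderiv \<alpha> (E $ \<gamma>))"

abbreviation \<A> :: "(complex, 'n) mfps set"
  where "\<A> \<equiv> generated_algebra generators"

lemma finite_generators: "finite generators"
  by (simp add: generators_def)

lemma c_in_\<A>: "c \<alpha> \<beta> \<gamma> \<in> \<A>"
  by (rule generated_algebra.gen) (auto simp: generators_def intro: range_eqI [of _ _ "(\<alpha>, \<beta>, \<gamma>)"])

lemma U_in_\<A>: "U \<beta> \<gamma> \<in> \<A>"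
  by (rule generated_algebra.gen) (auto simp: generators_def intro: range_eqI [of _ _ "(\<beta>, \<gamma>)"])

lemma pderiv_E_in_\<A>: "mfps_pderiv \<alpha> (E $ \<gamma>) \<in> \<A>"
  by (rule generated_algebra.gen) (auto simp: generators_def intro: range_eqI [of _ _ "(\<alpha>, \<gamma>)"])

lemmas \<A>_intros = generated_algebra.const generated_algebra.add generated_algebra.mult
  generated_algebra_0 generated_algebra_sum generated_algebra_diff c_in_\<A> U_in_\<A> pderiv_E_in_\<A>

lemma pderiv_U_in_\<A>: "mfps_pderiv \<alpha> (U \<beta> \<gamma>) \<in> \<A>"
  by (auto simp: pderiv_U intro!: \<A>_intros)

text \<open>\<open>\<A>\<close> need not contain the partial derivatives of \<open>c\<close>. But the polynomials in the
  entries of \<open>U\<close> alone have their partial derivatives in \<open>\<A>\<close>.\<close>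

lemma U_power_in_\<A>: "U_power k \<beta> \<gamma> \<in> \<A> \<and> mfps_pderiv \<alpha> (U_power k \<beta> \<gamma>) \<in> \<A>"
proof (induction k arbitrary: \<beta> \<gamma>)
  case 0
  then show ?case
    using generated_algebra.const [of 1] by (auto simp: generated_algebra_0)
next
  case (Suc k)
  then show ?case
    by (auto simp: mfps_pderiv_sum mfps_pderiv_mult intro!: \<A>_intros pderiv_U_in_\<A>)
qed

lemma spectral_function_in_\<A>:
  "spectral_function h \<beta> \<gamma> \<in> \<A>" "mfps_pderiv \<alpha> (spectral_function h \<beta> \<gamma>) \<in> \<A>"
  by (auto simp: spectral_function_def mfps_pderiv_sum mfps_pderiv_mult U_power_in_\<A> intro!: \<A>_intros)

lemma spectral_field_in_\<A>:
  "spectral_field h $ \<gamma> \<in> \<A>" "mfps_pderiv \<alpha> (spectral_field h $ \<gamma>) \<in> \<A>"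
  by (simp_all add: spectral_field_def spectral_function_in_\<A>)

text \<open>The step that closes the system. Potentiality exchanges the derivative along \<open>W = h(E)\<close> for one in
  direction \<open>\<beta>\<close>, and the product rule moves it to \<open>W\<close> and to the multiplication by \<open>W\<close>.
  That multiplication is \<open>h(U)\<close>, whose derivatives are in \<open>\<A>\<close>.\<close>

lemma spectral_field_apply_c:
  "vf_apply (spectral_field h) (c \<beta> \<gamma> \<delta>) = mfps_pderiv \<beta> (spectral_function h \<gamma> \<delta>)
    - (\<Sum>\<alpha>\<in>UNIV. mfps_pderiv \<beta> (spectral_field h $ \<alpha>) * c \<alpha> \<gamma> \<delta>)"
  unfolding vf_apply_def spectral_function_eq_multiplication [of h \<gamma> \<delta>] potential [of _ \<beta> \<gamma> \<delta>]
  by (simp add: mfps_pderiv_sum mfps_pderiv_mult sum.distrib)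

lemma spectral_field_preserves_\<A>:
  assumes "y \<in> generators"
  shows "vf_apply (spectral_field h) y \<in> \<A>"
proof -
  consider \<beta> \<gamma> \<delta> where "y = c \<beta> \<gamma> \<delta>" | \<beta> \<gamma> where "y = U \<beta> \<gamma>"
    | \<alpha> \<gamma> where "y = mfps_pderiv \<alpha> (E $ \<gamma>)"
    using assms by (auto simp: generators_def)
  then show ?thesis
  proof cases
    case 1
    then show ?thesis
      by (auto simp: spectral_field_apply_c intro!: \<A>_intros spectral_function_in_\<A> spectral_field_in_\<A>)
  next
    case 2
    then show ?thesis
      by (auto simp: vf_apply_def intro!: \<A>_intros pderiv_U_in_\<A> spectral_field_in_\<A>)
  next
    case 3
    then show ?thesis
      by (simp add: vf_apply_def affine generated_algebra_0)
  qed
qed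

text \<open>The characters at the origin diagonalize the multiplication by \<open>E\<close> there.\<close>

definition eigenvalue :: "'n \<Rightarrow> complex"
  where "eigenvalue i = (\<Sum>\<alpha>\<in>UNIV. E $ \<alpha> $$ 0 * \<phi> $ \<alpha> $ i)"

text \<open>The value at the origin of an endomorphism, written in the basis of the idempotents of the algebra at
  the origin: the columns of \<open>\<phi>\<close> are the characters, so the rows of its inverse are the
  idempotents.\<close>

definition idempotent_frame :: "('n \<Rightarrow> 'n \<Rightarrow> (complex, 'n) mfps) \<Rightarrow> complex^'n^'n"
  where "idempotent_frame M =
    matrix_inv \<phi> ** (\<chi> \<beta> \<gamma>. M \<beta> \<gamma> $$ 0) ** \<phi>"

lemma characters_inverse:
  "matrix_inv \<phi> ** \<phi> = mat 1"
  "\<phi> ** matrix_inv \<phi> = mat 1"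
  using invertible_characters by (simp_all add: matrix_inv_inverse)

lemma idempotent_frame_add:
  "idempotent_frame (\<lambda>\<beta> \<gamma>. M \<beta> \<gamma> + N \<beta> \<gamma>) = idempotent_frame M + idempotent_frame N"
  by (simp add: idempotent_frame_def matrix_matrix_mult_def vec_eq_iff sum.distrib
        distrib_left distrib_right)

lemma idempotent_frame_scale:
  "idempotent_frame (\<lambda>\<beta> \<gamma>. f * M \<beta> \<gamma>) $ i $ j = f $$ 0 * idempotent_frame M $ i $ j"
  by (simp add: idempotent_frame_def matrix_matrix_mult_def sum_distrib_left sum_distrib_right mult_ac)

lemma idempotent_frame_sum:
  "idempotent_frame (\<lambda>\<beta> \<gamma>. \<Sum>x\<in>I. M x \<beta> \<gamma>) = (\<Sum>x\<in>I. idempotent_frame (M x))"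
proof (induction I rule: infinite_finite_induct)
  case (insert x I)
  then show ?case by (simp add: idempotent_frame_add)
qed (simp_all add: idempotent_frame_def matrix_matrix_mult_def vec_eq_iff)

lemma idempotent_frame_diff:
  "idempotent_frame (\<lambda>\<beta> \<gamma>. M \<beta> \<gamma> - N \<beta> \<gamma>) = idempotent_frame M - idempotent_frame N"
  using idempotent_frame_add [of "\<lambda>\<beta> \<gamma>. M \<beta> \<gamma> - N \<beta> \<gamma>" N] by simp

lemma idempotent_frame_times:
  "idempotent_frame (\<lambda>\<beta> \<gamma>. \<Sum>\<delta>\<in>UNIV. M \<beta> \<delta> * N \<delta> \<gamma>) = idempotent_frame M ** idempotent_frame N"
proof -
  have "(\<chi> \<beta> \<gamma>. (\<Sum>\<delta>\<in>UNIV. M \<beta> \<delta> * N \<delta> \<gamma>) $$ 0) = (\<chi> \<beta> \<gamma>. M \<beta> \<gamma> $$ 0) ** (\<chi> \<beta> \<gamma>. N \<beta> \<gamma> $$ 0)"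
    by (simp add: vec_eq_iff matrix_matrix_mult_def mfps_nth_sum)
  moreover have "idempotent_frame M ** idempotent_frame N = matrix_inv \<phi> **
      (\<chi> \<beta> \<gamma>. M \<beta> \<gamma> $$ 0) ** (\<phi> ** matrix_inv \<phi>) ** (\<chi> \<beta> \<gamma>. N \<beta> \<gamma> $$ 0) ** \<phi>"
    by (simp only: idempotent_frame_def matrix_mul_assoc)
  ultimately show ?thesis
    by (simp add: idempotent_frame_def characters_inverse matrix_mul_assoc)
qed

lemma idempotent_frame_c: "idempotent_frame (c \<alpha>) = diagonal_matrix (\<lambda>i. \<phi> $ \<alpha> $ i)"
proof -
  have "(\<chi> \<beta> \<gamma>. c \<alpha> \<beta> \<gamma> $$ 0) ** \<phi> = \<phi> ** diagonal_matrix (\<lambda>i. \<phi> $ \<alpha> $ i)"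
    unfolding vec_eq_iff diagonal_matrix_times
    by (auto simp: matrix_matrix_mult_def characters [symmetric])
  then show ?thesis
    unfolding idempotent_frame_def matrix_mul_assoc [symmetric]
    by (simp add: matrix_mul_assoc characters_inverse)
qed

lemma idempotent_frame_U: "idempotent_frame U = diagonal_matrix eigenvalue"
proof -
  have "idempotent_frame U = (\<Sum>\<alpha>\<in>UNIV. idempotent_frame (\<lambda>\<beta> \<gamma>. E $ \<alpha> * c \<alpha> \<beta> \<gamma>))"
    unfolding idempotent_frame_sum [symmetric] U_def ..
  then show ?thesis
    by (auto simp: vec_eq_iff idempotent_frame_scale idempotent_frame_c diagonal_matrix_def eigenvalue_def
          intro!: sum.neutral)
qed

lemma idempotent_frame_U_power: "idempotent_frame (U_power k) = diagonal_matrix (\<lambda>i. eigenvalue i ^ k)"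
proof (induction k)
  case 0
  have "(\<chi> \<beta> \<gamma>. U_power 0 \<beta> \<gamma> $$ 0) = mat 1"
    by (simp add: mat_def vec_eq_iff mfps_nth_one)
  then have "idempotent_frame (U_power 0) = mat 1"
    by (simp only: idempotent_frame_def matrix_mul_rid characters_inverse)
  then show ?case
    by (simp add: diagonal_matrix_def mat_def del: U_power.simps)
next
  case (Suc k)
  have "U_power (Suc k) = (\<lambda>\<beta> \<gamma>. \<Sum>\<delta>\<in>UNIV. U_power k \<beta> \<delta> * U \<delta> \<gamma>)"
    by (intro ext) simp
  then have "idempotent_frame (U_power (Suc k)) = idempotent_frame (U_power k) ** idempotent_frame U"
    by (simp only: idempotent_frame_times)
  moreover have "diagonal_matrix (\<lambda>i. eigenvalue i ^ k) ** diagonal_matrix eigenvalue =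
      diagonal_matrix (\<lambda>i. eigenvalue i ^ Suc k)"
    by (simp add: vec_eq_iff diagonal_matrix_times) (simp add: diagonal_matrix_def)
  ultimately show ?case
    by (simp only: Suc.IH idempotent_frame_U)
qed

text \<open>The commutator of \<open>\<nabla>E\<close> with the diagonal matrix of \<open>C\<^sub>\<alpha>\<close> has vanishing diagonal.\<close>

lemma idempotent_frame_pderiv_U:
  "idempotent_frame (\<lambda>\<beta> \<gamma>. mfps_pderiv \<alpha> (U \<beta> \<gamma>)) $ i $ i = \<phi> $ \<alpha> $ i"
  unfolding pderiv_U idempotent_frame_add idempotent_frame_diff idempotent_frame_times idempotent_frame_c
  by (simp add: diagonal_matrix_times) (simp add: diagonal_matrix_def)

text \<open>On the diagonal the derivative of the power behaves as for commuting matrices, because \<open>U\<close>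
  itself is diagonal at the origin.\<close>

lemma idempotent_frame_pderiv_U_power:
  "idempotent_frame (\<lambda>\<beta> \<gamma>. mfps_pderiv \<alpha> (U_power k \<beta> \<gamma>)) $ i $ i =
    of_nat k * eigenvalue i ^ (k - 1) * \<phi> $ \<alpha> $ i"
proof (induction k)
  case 0
  have "mfps_pderiv \<alpha> (U_power 0 \<beta> \<gamma>) = 0" for \<beta> \<gamma>
    by simp
  then show ?case
    by (simp only: idempotent_frame_def) (simp add: matrix_matrix_mult_def)
next
  case (Suc k)
  have "idempotent_frame (\<lambda>\<beta> \<gamma>. mfps_pderiv \<alpha> (U_power (Suc k) \<beta> \<gamma>)) =
      idempotent_frame (\<lambda>\<beta> \<gamma>. mfps_pderiv \<alpha> (U_power k \<beta> \<gamma>)) ** idempotent_frame U +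
      idempotent_frame (U_power k) ** idempotent_frame (\<lambda>\<beta> \<gamma>. mfps_pderiv \<alpha> (U \<beta> \<gamma>))"
    unfolding idempotent_frame_times [symmetric] idempotent_frame_add [symmetric]
    by (simp add: mfps_pderiv_sum mfps_pderiv_mult sum.distrib)
  then have "idempotent_frame (\<lambda>\<beta> \<gamma>. mfps_pderiv \<alpha> (U_power (Suc k) \<beta> \<gamma>)) $ i $ i =
      of_nat k * eigenvalue i ^ (k - 1) * \<phi> $ \<alpha> $ i * eigenvalue i + eigenvalue i ^ k * \<phi> $ \<alpha> $ i"
    by (simp only: vector_add_component idempotent_frame_U idempotent_frame_U_power
          diagonal_matrix_times Suc.IH idempotent_frame_pderiv_U)
  then show ?case
    by (cases k) (simp_all only: , simp_all add: algebra_simps del: U_power.simps)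
qed

lemma idempotent_frame_spectral_function:
  "idempotent_frame (spectral_function h) = diagonal_matrix (\<lambda>i. poly h (eigenvalue i))"
proof -
  have "idempotent_frame (spectral_function h) =
      (\<Sum>k\<le>degree h. idempotent_frame (\<lambda>\<beta> \<gamma>. mfps_const (coeff h k) * U_power k \<beta> \<gamma>))"
    unfolding idempotent_frame_sum [symmetric] spectral_function_def ..
  then show ?thesis
    by (auto simp: vec_eq_iff idempotent_frame_scale idempotent_frame_U_power diagonal_matrix_def poly_altdef)
qed

lemma idempotent_frame_pderiv_spectral_function:
  "idempotent_frame (\<lambda>\<beta> \<gamma>. mfps_pderiv \<alpha> (spectral_function h \<beta> \<gamma>)) $ i $ i =
    poly (pderiv h) (eigenvalue i) * \<phi> $ \<alpha> $ i"
proof -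
  have "idempotent_frame (\<lambda>\<beta> \<gamma>. mfps_pderiv \<alpha> (spectral_function h \<beta> \<gamma>)) = (\<Sum>k\<le>degree h.
      idempotent_frame (\<lambda>\<beta> \<gamma>. mfps_const (coeff h k) * mfps_pderiv \<alpha> (U_power k \<beta> \<gamma>)))"
    unfolding idempotent_frame_sum [symmetric] spectral_function_def
    by (simp add: mfps_pderiv_sum mfps_pderiv_const_times)
  then have "idempotent_frame (\<lambda>\<beta> \<gamma>. mfps_pderiv \<alpha> (spectral_function h \<beta> \<gamma>)) $ i $ i =
      (\<Sum>k\<le>degree h. coeff h k * (of_nat k * eigenvalue i ^ (k - 1))) * \<phi> $ \<alpha> $ i"
    by (simp add: idempotent_frame_scale idempotent_frame_pderiv_U_power sum_distrib_right mult.assoc)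
  also have "(\<Sum>k\<le>degree h. coeff h k * (of_nat k * eigenvalue i ^ (k - 1))) = poly (pderiv h) (eigenvalue i)"
    by (simp add: poly_pderiv_eq_sum)
  finally show ?thesis .
qed

lemma idempotent_frame_multiplication:
  "idempotent_frame (\<lambda>\<beta> \<gamma>. \<Sum>\<alpha>\<in>UNIV. X \<alpha> * c \<alpha> \<beta> \<gamma>) $ i $ i = (\<Sum>\<alpha>\<in>UNIV. \<phi> $ \<alpha> $ i * X \<alpha> $$ 0)"
  by (simp add: idempotent_frame_sum idempotent_frame_scale idempotent_frame_c)
     (simp add: diagonal_matrix_def mult.commute)

lemma eq_if_characters_eq:
  fixes x y :: "'n \<Rightarrow> complex"
  assumes "\<And>i. (\<Sum>\<alpha>\<in>UNIV. \<phi> $ \<alpha> $ i * x \<alpha>) = (\<Sum>\<alpha>\<in>UNIV. \<phi> $ \<alpha> $ i * y \<alpha>)"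
  shows "x \<alpha> = y \<alpha>"
proof -
  have "(\<chi> \<alpha>. x \<alpha>) v* \<phi> = (\<chi> \<alpha>. y \<alpha>) v* \<phi>"
    using assms by (simp add: vec_eq_iff vector_matrix_mult_def mult.commute)
  then have "(\<chi> \<alpha>. x \<alpha>) v* (\<phi> ** matrix_inv \<phi>) = (\<chi> \<alpha>. y \<alpha>) v* (\<phi> ** matrix_inv \<phi>)"
    by (simp flip: vector_matrix_mul_assoc)
  then show ?thesis
    by (simp add: characters_inverse vec_eq_iff)
qed

context
  fixes h :: "complex poly"
  assumes h: "\<And>i. poly h (eigenvalue i) = 0" "\<And>i. poly (pderiv h) (eigenvalue i) = 1"
begin

lemma spectral_field_nth_0: "spectral_field h $ \<gamma> $$ 0 = 0"
proof -
  have "(\<Sum>\<alpha>\<in>UNIV. \<phi> $ \<alpha> $ i * spectral_field h $ \<alpha> $$ 0) = 0" for i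
    unfolding idempotent_frame_multiplication [symmetric] spectral_function_eq_multiplication [symmetric]
    by (simp add: idempotent_frame_spectral_function h diagonal_matrix_def)
  then show ?thesis
    using eq_if_characters_eq [of "\<lambda>\<alpha>. spectral_field h $ \<alpha> $$ 0" "\<lambda>\<alpha>. 0" \<gamma>] by simp
qed

text \<open>Since \<open>W = h(E)\<close> vanishes at the origin, the derivative of the multiplication by \<open>W\<close> is there
  the multiplication by the derivative of \<open>W\<close>. Its diagonal entries in the frame of idempotents are
  therefore the characters of \<open>\<partial>\<^sub>\<kappa> W\<close>; computed from \<open>h(U)\<close> they are
  \<open>h'\<close> at the eigenvalues times the characters of \<open>\<Delta>\<^sub>\<kappa>\<close>, and \<open>h'\<close> is
  \<open>1\<close> there.\<close>

lemma spectral_field_nth_axis: "spectral_field h $ \<gamma> $$ axis \<kappa> 1 = (if \<gamma> = \<kappa> then 1 else 0)"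
proof -
  have "(\<chi> \<beta> \<gamma>. mfps_pderiv \<kappa> (spectral_function h \<beta> \<gamma>) $$ 0) =
      (\<chi> \<beta> \<gamma>. (\<Sum>\<alpha>\<in>UNIV. mfps_pderiv \<kappa> (spectral_field h $ \<alpha>) * c \<alpha> \<beta> \<gamma>) $$ 0)"
    unfolding spectral_function_eq_multiplication
    by (simp add: vec_eq_iff mfps_pderiv_sum mfps_pderiv_mult mfps_nth_sum spectral_field_nth_0)
  then have "idempotent_frame (\<lambda>\<beta> \<gamma>. mfps_pderiv \<kappa> (spectral_function h \<beta> \<gamma>)) =
      idempotent_frame (\<lambda>\<beta> \<gamma>. \<Sum>\<alpha>\<in>UNIV. mfps_pderiv \<kappa> (spectral_field h $ \<alpha>) * c \<alpha> \<beta> \<gamma>)"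
    by (simp add: idempotent_frame_def)
  then have "(\<Sum>\<alpha>\<in>UNIV. \<phi> $ \<alpha> $ i * mfps_pderiv \<kappa> (spectral_field h $ \<alpha>) $$ 0) = \<phi> $ \<kappa> $ i" for i
    using idempotent_frame_pderiv_spectral_function [of \<kappa> h i]
    by (simp add: idempotent_frame_multiplication h)
  then have "mfps_pderiv \<kappa> (spectral_field h $ \<gamma>) $$ 0 = (if \<gamma> = \<kappa> then 1 else 0)"
    by (intro eq_if_characters_eq [of _ "\<lambda>\<gamma>. if \<gamma> = \<kappa> then 1 else 0"])
       (simp add: if_distrib cong: if_cong)
  then show ?thesis
    by (simp add: mfps_pderiv_nth)
qed

end

text \<open>With \<open>h\<close> vanishing to first order with slope \<open>1\<close> at each eigenvalue of \<open>U\<close> at the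
  origin, the field \<open>h(E)\<close> is radial to first order and the generators solve a polynomial system
  along it.\<close>

theorem structure_constants_convergent:
  "\<exists>\<rho>>0. \<forall>f\<in>\<A>. \<exists>C. \<forall>k. (\<Sum>l\<le>k. weighted_norm \<rho> l f) \<le> C"
proof -
  obtain h where h: "\<forall>x\<in>range eigenvalue. poly h x = 0 \<and> poly (pderiv h) x = 1"
    using poly_simple_zeros_unit_slope [of "range eigenvalue"] by auto
  show ?thesis
    by (rule Euler_type_system_convergent [where W = "spectral_field h"])
       (use h in \<open>simp_all add: finite_generators spectral_field_nth_0 spectral_field_nth_axis
          spectral_field_in_\<A> spectral_field_preserves_\<A> del: One_nat_def\<close>)
qed

end


section \<open>Frobenius manifolds\<close>

lemma sum_axis_times:
  fixes g :: "'n::finite \<Rightarrow> 'a::semiring_1"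
  shows "(\<Sum>\<alpha>\<in>UNIV. axis \<beta> 1 $ \<alpha> * g \<alpha>) = g \<beta>"
  by (simp add: axis_def mult_delta_left)

lemma mfps_pderiv_axis [simp]: "mfps_pderiv \<alpha> (axis \<beta> 1 $ \<gamma>) = 0"
  by (simp add: axis_def)

lemma lie_bracket_axis: "lie_bracket E (axis \<alpha> 1) $ \<gamma> = - mfps_pderiv \<alpha> (E $ \<gamma>)"
  by (simp add: lie_bracket_def vf_apply_def sum_axis_times)

context based_metric_space
begin

lemma basis_coefficient_eq_0:
  assumes "(\<Sum>\<alpha>\<in>UNIV. scale (x \<alpha>) (\<Delta> \<alpha>)) = 0"
  shows "x \<alpha> = 0"
proof -
  have "(\<Sum>v\<in>range \<Delta>. scale (x (inv \<Delta> v)) v) = 0"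
    using assms by (simp add: sum.reindex [OF inj_basis] inj_basis)
  then have "x (inv \<Delta> (\<Delta> \<alpha>)) = 0"
    using independentD [OF independent_basis _ order_refl, of "\<lambda>v. x (inv \<Delta> v)" "\<Delta> \<alpha>"] by simp
  then show ?thesis
    by (simp add: inj_basis)
qed

lemma metric_sum_right: "\<eta> x (\<Sum>i\<in>I. scale (a i) (y i)) = (\<Sum>i\<in>I. a i * \<eta> x (y i))"
proof -
  interpret l: Vector_Spaces.linear scale "(*)" "\<eta> x"
    by (rule linear_metric)
  show ?thesis
    by (simp add: l.sum l.scale)
qed

lemma gram_left_kernel:
  assumes "x v* gram = 0"
  shows "x = 0"
proof -
  define y where "y = (\<Sum>\<alpha>\<in>UNIV. scale (x $ \<alpha>) (\<Delta> \<alpha>))"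
  have basis: "\<eta> (\<Delta> \<beta>) y = 0" for \<beta>
  proof -
    have "(\<Sum>\<alpha>\<in>UNIV. x $ \<alpha> * \<eta> (\<Delta> \<alpha>) (\<Delta> \<beta>)) = 0"
      using assms by (simp add: gram_def vector_matrix_mult_def vec_eq_iff mult.commute)
    then show ?thesis
      unfolding y_def metric_sum_right using sym_metric [of "\<Delta> \<beta>"] by simp
  qed
  have "\<eta> y z = 0" for z
  proof -
    interpret l: Vector_Spaces.linear scale "(*)" "\<eta> y"
      by (rule linear_metric)
    show ?thesis
      using l.eq_0_on_span [of "range \<Delta>" z] basis sym_metric [of y] span_basis by auto
  qed
  then have "\<eta> y = \<eta> 0"
    by (metis (full_types) ext linear_metric module_hom.zero sym_metric Vector_Spaces.linear_def module_hom_iff_linear)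
  then have "y = 0"
    using nondegenerate_metric by (auto simp: bij_betw_def inj_on_def)
  then have "x $ \<alpha> = 0" for \<alpha>
    by (auto simp: y_def intro: basis_coefficient_eq_0)
  then show ?thesis
    by (simp add: vec_eq_iff)
qed

lemma gram_inverse: "gram ** gram_inv = mat 1" "gram_inv ** gram = mat 1"
  using matrix_inv_inverse [OF invertible_if_left_kernel_trivial [of gram]] gram_left_kernel
  by (auto simp: gram_inv_def)

lemma third_deriv_eq_struct_const:
  "third_deriv \<Phi> \<alpha> \<beta> \<gamma> = (\<Sum>\<delta>\<in>UNIV. struct_const \<Phi> \<alpha> \<beta> \<delta> * mfps_const (gram $ \<delta> $ \<gamma>))"
proof -
  have "(\<Sum>\<delta>\<in>UNIV. struct_const \<Phi> \<alpha> \<beta> \<delta> * mfps_const (gram $ \<delta> $ \<gamma>)) =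
      (\<Sum>\<epsilon>\<in>UNIV. \<Sum>\<delta>\<in>UNIV. third_deriv \<Phi> \<alpha> \<beta> \<epsilon> * mfps_const (gram_inv $ \<epsilon> $ \<delta> * gram $ \<delta> $ \<gamma>))"
    unfolding struct_const_def sum_distrib_right
    by (rule trans [OF sum.swap]) (simp add: mfps_const_mult mult.assoc)
  also have "\<dots> = (\<Sum>\<epsilon>\<in>UNIV. third_deriv \<Phi> \<alpha> \<beta> \<epsilon> * mfps_const ((gram_inv ** gram) $ \<epsilon> $ \<gamma>))"
    by (simp add: matrix_matrix_mult_def mfps_const_sum sum_distrib_left)
  also have "\<dots> = third_deriv \<Phi> \<alpha> \<beta> \<gamma>"
    by (simp add: gram_inverse mat_def if_distrib cong: if_cong)
  finally show ?thesis ..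
qed

lemma third_deriv_sym: "third_deriv \<Phi> \<alpha> \<beta> \<gamma> = third_deriv \<Phi> \<beta> \<alpha> \<gamma>"
  "third_deriv \<Phi> \<alpha> \<beta> \<gamma> = third_deriv \<Phi> \<alpha> \<gamma> \<beta>"
  unfolding third_deriv_def by (metis mfps_pderiv_commute)+

lemma prod_K_axis: "prod_K \<Phi> (axis \<alpha> 1) (axis \<beta> 1) $ \<gamma> = struct_const \<Phi> \<alpha> \<beta> \<gamma>"
  by (simp add: prod_K_def mult.assoc sum_axis_times flip: sum_distrib_left)

lemma prod_K_axis_right: "prod_K \<Phi> X (axis \<beta> 1) $ \<gamma> = (\<Sum>\<alpha>\<in>UNIV. X $ \<alpha> * struct_const \<Phi> \<alpha> \<beta> \<gamma>)"
  by (simp add: prod_K_def mult.assoc sum_axis_times flip: sum_distrib_left)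

lemma prod_K_axis_left: "prod_K \<Phi> (axis \<alpha> 1) Y $ \<gamma> = (\<Sum>\<beta>\<in>UNIV. Y $ \<beta> * struct_const \<Phi> \<alpha> \<beta> \<gamma>)"
  by (simp add: prod_K_def mult.assoc sum_axis_times flip: sum_distrib_left)

text \<open>The WDVV equations exchange the two outer indices of
  \<open>\<Phi>\<^sub>\<alpha>\<^sub>\<beta>\<^sub>\<gamma> \<eta>\<^sup>\<gamma>\<^sup>\<delta> \<Phi>\<^sub>\<delta>\<^sub>\<epsilon>\<^sub>\<phi>\<close>; with the symmetry of third derivatives this makes
  the expression symmetric in all four indices.\<close>

lemma struct_const_assoc:
  assumes "WDVV \<Phi>"
  shows "(\<Sum>\<delta>\<in>UNIV. struct_const \<Phi> \<alpha> \<beta> \<delta> * struct_const \<Phi> \<delta> \<epsilon> \<kappa>) =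
    (\<Sum>\<delta>\<in>UNIV. struct_const \<Phi> \<beta> \<epsilon> \<delta> * struct_const \<Phi> \<alpha> \<delta> \<kappa>)"
proof -
  define g where "g \<alpha> \<beta> \<epsilon> \<phi> = (\<Sum>\<delta>\<in>UNIV. struct_const \<Phi> \<alpha> \<beta> \<delta> * third_deriv \<Phi> \<delta> \<epsilon> \<phi>)" for \<alpha> \<beta> \<epsilon> \<phi>
  have g_eq: "g \<alpha> \<beta> \<epsilon> \<phi> = (\<Sum>\<gamma>\<in>UNIV. \<Sum>\<delta>\<in>UNIV.
      third_deriv \<Phi> \<alpha> \<beta> \<gamma> * mfps_const (gram_inv $ \<gamma> $ \<delta>) * third_deriv \<Phi> \<delta> \<epsilon> \<phi>)" for \<alpha> \<beta> \<epsilon> \<phi>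
    unfolding g_def struct_const_def sum_distrib_right by (rule sum.swap)
  have swap14: "g \<alpha> \<beta> \<epsilon> \<phi> = g \<phi> \<beta> \<epsilon> \<alpha>" for \<alpha> \<beta> \<epsilon> \<phi>
    using assms unfolding WDVV_def g_eq by blast
  have swap12: "g \<alpha> \<beta> \<epsilon> \<phi> = g \<beta> \<alpha> \<epsilon> \<phi>" for \<alpha> \<beta> \<epsilon> \<phi>
    unfolding g_def struct_const_def third_deriv_sym(1) [of _ \<alpha> \<beta>] ..
  have swap34: "g \<alpha> \<beta> \<epsilon> \<phi> = g \<alpha> \<beta> \<phi> \<epsilon>" for \<alpha> \<beta> \<epsilon> \<phi>
    unfolding g_def third_deriv_sym(2) [of _ _ \<epsilon> \<phi>] ..
  \<comment> \<open>The three transpositions generate the symmetric group, so \<open>g\<close> is totally symmetric.\<close>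
  have "g \<alpha> \<beta> \<epsilon> \<phi> = g \<beta> \<epsilon> \<alpha> \<phi>" for \<phi>
    by (metis swap12 swap14 swap34)
  moreover have "(\<Sum>\<delta>\<in>UNIV. struct_const \<Phi> \<alpha> \<beta> \<delta> * struct_const \<Phi> \<delta> \<epsilon> \<kappa>) =
      (\<Sum>\<phi>\<in>UNIV. g \<alpha> \<beta> \<epsilon> \<phi> * mfps_const (gram_inv $ \<phi> $ \<kappa>))" for \<alpha> \<beta> \<epsilon>
    unfolding g_def struct_const_def [of _ _ \<epsilon> \<kappa>] sum_distrib_left sum_distrib_right
    by (rule trans [OF sum.swap]) (simp add: mult.assoc)
  moreover have "struct_const \<Phi> \<alpha> \<delta> \<kappa> = struct_const \<Phi> \<delta> \<alpha> \<kappa>" for \<delta>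
    unfolding struct_const_def third_deriv_sym(1) [of _ \<alpha> \<delta>] ..
  ultimately show ?thesis
    by simp
qed

lemma coord_basis: "coord \<alpha> (\<Delta> \<beta>) = (if \<alpha> = \<beta> then 1 else 0)"
  using representation_basis [OF independent_basis, of "\<Delta> \<beta>"] inj_basis
  by (auto simp: coord_def inj_eq)

lemma prod_0_basis: "prod_0 \<Phi> (\<Delta> \<alpha>) (\<Delta> \<beta>) = (\<Sum>\<gamma>\<in>UNIV. scale (struct_const \<Phi> \<alpha> \<beta> \<gamma> $$ 0) (\<Delta> \<gamma>))"
  unfolding prod_0_def coord_basis mult.assoc sum_distrib_left [symmetric]
  by (simp add: mult_delta_left)

end

context semisimple_formal_frobenius_manifold
begin

text \<open>A conformal Killing field with constant conformal factor is affine: the tensor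
  \<open>\<partial>\<^sub>\<gamma> \<partial>\<^sub>\<alpha> E\<^sub>\<beta>\<close> is symmetric in \<open>\<gamma>\<close>, \<open>\<alpha>\<close> and
  antisymmetric in \<open>\<alpha>\<close>, \<open>\<beta>\<close>, hence zero.\<close>

lemma Euler_field_affine: "mfps_pderiv \<alpha> (mfps_pderiv \<beta> (E $ \<gamma>)) = 0"
proof -
  \<comment> \<open>\<open>a \<alpha> \<beta>\<close> is \<open>\<partial>\<^sub>\<alpha> E\<^sub>\<beta>\<close>, the index of \<open>E\<close> being lowered with the metric.\<close>
  define a where "a \<alpha> \<beta> = (\<Sum>\<delta>\<in>UNIV. mfps_pderiv \<alpha> (E $ \<delta>) * mfps_const (gram $ \<delta> $ \<beta>))" for \<alpha> \<beta>
  obtain D where D: "\<And>X Y. vf_apply E (metric_K X Y) - metric_K (lie_bracket E X) Y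
      - metric_K X (lie_bracket E Y) = mfps_const D * metric_K X Y"
    using euler unfolding euler_element_def by blast
  have gram_sym: "gram $ \<alpha> $ \<beta> = gram $ \<beta> $ \<alpha>" for \<alpha> \<beta>
    using sym_metric by (simp add: gram_def)
  have met: "metric_K X (axis \<beta> 1) = (\<Sum>\<alpha>\<in>UNIV. X $ \<alpha> * mfps_const (gram $ \<alpha> $ \<beta>))"
    "metric_K (axis \<beta> 1) X = (\<Sum>\<alpha>\<in>UNIV. X $ \<alpha> * mfps_const (gram $ \<alpha> $ \<beta>))" for X :: "'b vfield" and \<beta>
    using gram_sym
    by (simp_all add: metric_K_def mult.assoc sum_axis_times flip: sum_distrib_left)
  have "a \<alpha> \<beta> + a \<beta> \<alpha> = mfps_const (D * gram $ \<alpha> $ \<beta>)" for \<alpha> \<beta>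
    using D [of "axis \<alpha> 1" "axis \<beta> 1"]
    by (simp add: met a_def lie_bracket_axis sum_axis_times sum_negf vf_apply_def mfps_const_mult)
  then have antisym: "mfps_pderiv \<gamma> (a \<alpha> \<beta>) = - mfps_pderiv \<gamma> (a \<beta> \<alpha>)" for \<alpha> \<beta> \<gamma>
    by (metis add_eq_0_iff2 mfps_pderiv_add mfps_pderiv_const)
  have sym: "mfps_pderiv \<gamma> (a \<alpha> \<beta>) = mfps_pderiv \<alpha> (a \<gamma> \<beta>)" for \<alpha> \<beta> \<gamma>
    by (simp add: a_def mfps_pderiv_sum mfps_pderiv_mult mfps_pderiv_commute [of \<gamma> \<alpha>])
  have a0: "mfps_pderiv \<gamma> (a \<alpha> \<beta>) = 0" for \<alpha> \<beta> \<gamma>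
  proof -
    have "mfps_pderiv \<gamma> (a \<alpha> \<beta>) = - mfps_pderiv \<gamma> (a \<alpha> \<beta>)"
      by (metis antisym sym)
    then have "mfps_pderiv \<gamma> (a \<alpha> \<beta>) $$ m = - (mfps_pderiv \<gamma> (a \<alpha> \<beta>) $$ m)" for m
      by (metis mfps_nth_uminus)
    then show ?thesis
      by (intro mfps_eqI) simp
  qed
  have "mfps_pderiv \<beta> (E $ \<gamma>) = (\<Sum>\<delta>\<in>UNIV. a \<beta> \<delta> * mfps_const (gram_inv $ \<delta> $ \<gamma>))"
  proof -
    have "(\<Sum>\<delta>\<in>UNIV. a \<beta> \<delta> * mfps_const (gram_inv $ \<delta> $ \<gamma>)) = (\<Sum>\<epsilon>\<in>UNIV. \<Sum>\<delta>\<in>UNIV.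
        mfps_pderiv \<beta> (E $ \<epsilon>) * mfps_const (gram $ \<epsilon> $ \<delta> * gram_inv $ \<delta> $ \<gamma>))"
      unfolding a_def sum_distrib_right
      by (rule trans [OF sum.swap]) (simp add: mfps_const_mult mult.assoc)
    also have "\<dots> = (\<Sum>\<epsilon>\<in>UNIV. mfps_pderiv \<beta> (E $ \<epsilon>) * mfps_const ((gram ** gram_inv) $ \<epsilon> $ \<gamma>))"
      by (simp add: matrix_matrix_mult_def mfps_const_sum sum_distrib_left)
    also have "\<dots> = mfps_pderiv \<beta> (E $ \<gamma>)"
      by (simp add: gram_inverse mat_def if_distrib cong: if_cong)
    finally show ?thesis ..
  qed
  then show ?thesis
    by (simp add: mfps_pderiv_sum mfps_pderiv_mult a0)
qed

lemma Euler_field_struct_const: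
  "vf_apply E (struct_const \<Phi> \<alpha> \<beta> \<gamma>) = struct_const \<Phi> \<alpha> \<beta> \<gamma>
    + (\<Sum>\<delta>\<in>UNIV. struct_const \<Phi> \<alpha> \<beta> \<delta> * mfps_pderiv \<delta> (E $ \<gamma>))
    - (\<Sum>\<delta>\<in>UNIV. mfps_pderiv \<alpha> (E $ \<delta>) * struct_const \<Phi> \<delta> \<beta> \<gamma>)
    - (\<Sum>\<delta>\<in>UNIV. mfps_pderiv \<beta> (E $ \<delta>) * struct_const \<Phi> \<alpha> \<delta> \<gamma>)"
proof -
  have "lie_bracket E (prod_K \<Phi> (axis \<alpha> 1) (axis \<beta> 1)) - prod_K \<Phi> (lie_bracket E (axis \<alpha> 1)) (axis \<beta> 1)
      - prod_K \<Phi> (axis \<alpha> 1) (lie_bracket E (axis \<beta> 1)) = prod_K \<Phi> (axis \<alpha> 1) (axis \<beta> 1)"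
    using euler unfolding euler_element_def by blast
  then have "(lie_bracket E (prod_K \<Phi> (axis \<alpha> 1) (axis \<beta> 1)) - prod_K \<Phi> (lie_bracket E (axis \<alpha> 1)) (axis \<beta> 1)
      - prod_K \<Phi> (axis \<alpha> 1) (lie_bracket E (axis \<beta> 1))) $ \<gamma> = prod_K \<Phi> (axis \<alpha> 1) (axis \<beta> 1) $ \<gamma>"
    by simp
  moreover have "lie_bracket E (prod_K \<Phi> (axis \<alpha> 1) (axis \<beta> 1)) $ \<gamma> =
      vf_apply E (struct_const \<Phi> \<alpha> \<beta> \<gamma>) - (\<Sum>\<delta>\<in>UNIV. struct_const \<Phi> \<alpha> \<beta> \<delta> * mfps_pderiv \<delta> (E $ \<gamma>))"
    by (simp add: lie_bracket_def vf_apply_def [of "prod_K _ _ _"] prod_K_axis)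
  ultimately show ?thesis
    by (simp add: prod_K_axis prod_K_axis_left prod_K_axis_right lie_bracket_axis sum_negf
          sum_axis_times algebra_simps)
qed

lemma struct_const_semisimple_flat_F_manifold:
  "\<exists>\<phi>. semisimple_flat_F_manifold (struct_const \<Phi>) i\<^sub>1 E \<phi>"
proof -
  obtain f :: "'a \<Rightarrow> complex^'b" where f: "Vector_Spaces.linear scale (*s) f" "bij f"
    and mult: "\<And>x y. f (prod_0 \<Phi> x y) = f x * f y"
    using semisimple unfolding semisimple_at_0_def by blast
  interpret f: Vector_Spaces.linear scale "(*s)" f
    by (rule f(1))
  define \<phi> where "\<phi> = (\<chi> \<alpha> i. f (\<Delta> \<alpha>) $ i)"
  have f_sum: "f (\<Sum>\<alpha>\<in>UNIV. scale (x \<alpha>) (\<Delta> \<alpha>)) $ i = (\<Sum>\<alpha>\<in>UNIV. x \<alpha> * \<phi> $ \<alpha> $ i)" for x i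
    by (simp add: f.sum f.scale \<phi>_def)
  show ?thesis
  proof (intro exI [of _ \<phi>] semisimple_flat_F_manifold.intro)
    show "struct_const \<Phi> i\<^sub>1 \<beta> \<gamma> = (if \<beta> = \<gamma> then 1 else 0)" for \<beta> \<gamma>
      using flat_identity(1) [of "axis \<beta> 1"] prod_K_axis [of \<Phi> i\<^sub>1 \<beta> \<gamma>] by (auto simp: axis_def)
    show "mfps_pderiv \<delta> (struct_const \<Phi> \<alpha> \<beta> \<gamma>) = mfps_pderiv \<alpha> (struct_const \<Phi> \<delta> \<beta> \<gamma>)" for \<alpha> \<beta> \<gamma> \<delta>
      by (simp add: struct_const_def third_deriv_def mfps_pderiv_sum mfps_pderiv_mult mfps_pderiv_commute [of \<delta> \<alpha>])
    show "\<phi> $ \<alpha> $ i * \<phi> $ \<beta> $ i = (\<Sum>\<gamma>\<in>UNIV. struct_const \<Phi> \<alpha> \<beta> \<gamma> $$ 0 * \<phi> $ \<gamma> $ i)" for \<alpha> \<beta> i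
      using mult [of "\<Delta> \<alpha>" "\<Delta> \<beta>"] unfolding f_sum [symmetric] prod_0_basis [symmetric]
      by (simp add: \<phi>_def)
    show "invertible \<phi>"
    proof (rule invertible_if_left_kernel_trivial)
      fix x :: "complex^'b" assume "x v* \<phi> = 0"
      then have "f (\<Sum>\<alpha>\<in>UNIV. scale (x $ \<alpha>) (\<Delta> \<alpha>)) = 0"
        by (simp add: vec_eq_iff f_sum vector_matrix_mult_def)
      then have "(\<Sum>\<alpha>\<in>UNIV. scale (x $ \<alpha>) (\<Delta> \<alpha>)) = 0"
        using f(2) f.zero by (metis bij_is_inj injD)
      then show "x = 0"
        by (auto simp: vec_eq_iff intro: basis_coefficient_eq_0)
    qed
  qed (use struct_const_assoc [OF wdvv] Euler_field_struct_const Euler_field_affine in auto)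
qed

end


section \<open>Convergence of the potential\<close>

lemma degree_norm_third_deriv_le:
  "degree_norm (k + 3) \<Phi> \<le> (\<Sum>\<gamma>\<in>UNIV. \<Sum>\<beta>\<in>UNIV. \<Sum>\<alpha>\<in>UNIV.
    degree_norm k (mfps_pderiv \<alpha> (mfps_pderiv \<beta> (mfps_pderiv \<gamma> \<Phi>))))"
proof -
  have "degree_norm (k + 3) \<Phi> \<le> (\<Sum>\<gamma>\<in>UNIV. degree_norm (Suc (Suc k)) (mfps_pderiv \<gamma> \<Phi>))"
    using degree_norm_le_pderiv [of "Suc (Suc k)" \<Phi>] by (simp add: numeral_3_eq_3)
  also have "\<dots> \<le> (\<Sum>\<gamma>\<in>UNIV. \<Sum>\<beta>\<in>UNIV. degree_norm (Suc k) (mfps_pderiv \<beta> (mfps_pderiv \<gamma> \<Phi>)))"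
    by (intro sum_mono degree_norm_le_pderiv)
  also have "\<dots> \<le> (\<Sum>\<gamma>\<in>UNIV. \<Sum>\<beta>\<in>UNIV. \<Sum>\<alpha>\<in>UNIV.
      degree_norm k (mfps_pderiv \<alpha> (mfps_pderiv \<beta> (mfps_pderiv \<gamma> \<Phi>))))"
    by (intro sum_mono degree_norm_le_pderiv)
  finally show ?thesis .
qed

lemma abs_conv_points_if_weighted_norm_bounded:
  fixes f :: "(complex, 'n::finite) mfps"
  assumes "0 \<le> \<rho>" "\<And>k. (\<Sum>l\<le>k. weighted_norm \<rho> l f) \<le> C"
    and t: "\<And>\<alpha>. norm (t $ \<alpha>) \<le> \<rho>"
  shows "t \<in> abs_conv_points f"
proof -
  let ?g = "\<lambda>m. norm (f $$ m * (\<Prod>\<alpha>\<in>UNIV. (t $ \<alpha>) ^ (m $ \<alpha>)))"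
  have g_le: "?g m \<le> norm (f $$ m) * \<rho> ^ multi_degree m" for m
  proof -
    have "(\<Prod>\<alpha>\<in>UNIV. norm (t $ \<alpha>) ^ (m $ \<alpha>)) \<le> (\<Prod>\<alpha>\<in>UNIV. \<rho> ^ (m $ \<alpha>))"
      using t by (intro prod_mono) (auto intro: power_mono)
    also have "\<dots> = \<rho> ^ multi_degree m"
      by (simp add: multi_degree_def power_sum)
    finally show ?thesis
      by (simp add: norm_mult prod_norm [symmetric] norm_power mult_left_mono)
  qed
  have "sum ?g F \<le> C" if "finite F" for F
  proof -
    define k where "k = Max (insert 0 (multi_degree ` F))"
    have "F \<subseteq> (\<Union>l\<le>k. {m. multi_degree m = l})"
      using that by (auto simp: k_def)
    then have "sum ?g F \<le> sum ?g (\<Union>l\<le>k. {m. multi_degree m = l})"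
      by (intro sum_mono2) (auto simp: finite_multi_degree)
    also have "\<dots> = (\<Sum>l\<le>k. \<Sum>m | multi_degree m = l. ?g m)"
      by (rule sum.UNION_disjoint) (auto simp: finite_multi_degree)
    also have "\<dots> \<le> (\<Sum>l\<le>k. weighted_norm \<rho> l f)"
      unfolding weighted_norm_def degree_norm_def sum_distrib_right
      by (intro sum_mono order_trans [OF g_le]) auto
    also have "\<dots> \<le> C"
      by (rule assms(2))
    finally show ?thesis .
  qed
  then have "?g summable_on UNIV"
    by (intro nonneg_bdd_above_summable_on) (auto simp: bdd_above_def)
  then show ?thesis
    by (simp add: abs_conv_points_def)
qed

lemma convergence_domain_nonempty:
  fixes \<Phi> :: "(complex, 'n::finite) mfps"
  assumes "0 < \<rho>"
    and bound: "\<And>\<alpha> \<beta> \<gamma>. \<exists>C. \<forall>k. (\<Sum>l\<le>k. weighted_norm \<rho> l (mfps_pderiv \<alpha> (mfps_pderiv \<beta> (mfps_pderiv \<gamma> \<Phi>)))) \<le> C"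
  shows "convergence_domain \<Phi> \<noteq> {}"
proof -
  let ?d = "\<lambda>\<alpha> \<beta> \<gamma>. mfps_pderiv \<alpha> (mfps_pderiv \<beta> (mfps_pderiv \<gamma> \<Phi>))"
  obtain C where C: "\<And>\<alpha> \<beta> \<gamma> k. (\<Sum>l\<le>k. weighted_norm \<rho> l (?d \<alpha> \<beta> \<gamma>)) \<le> C \<alpha> \<beta> \<gamma>"
    using bound by metis
  define B where "B = (\<Sum>l<3. weighted_norm \<rho> l \<Phi>) + (\<Sum>\<gamma>\<in>UNIV. \<Sum>\<beta>\<in>UNIV. \<Sum>\<alpha>\<in>UNIV. C \<alpha> \<beta> \<gamma>) * \<rho> ^ 3"
  have "(\<Sum>l\<le>k. weighted_norm \<rho> l \<Phi>) \<le> B" for k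
  proof -
    have "(\<Sum>l\<le>k. weighted_norm \<rho> l \<Phi>) \<le> (\<Sum>l\<in>{..<3} \<union> (\<lambda>l. l + 3) ` {..k}. weighted_norm \<rho> l \<Phi>)"
    proof (rule sum_mono2)
      show "{..k} \<subseteq> {..<3} \<union> (\<lambda>l. l + 3) ` {..k}"
      proof
        fix l assume "l \<in> {..k}"
        then show "l \<in> {..<3} \<union> (\<lambda>l. l + 3) ` {..k}"
          by (cases "l < 3") (auto intro!: image_eqI [of _ _ "l - 3"])
      qed
    qed (use assms(1) in \<open>auto simp: weighted_norm_nonneg\<close>)
    also have "\<dots> = (\<Sum>l<3. weighted_norm \<rho> l \<Phi>) + (\<Sum>l\<le>k. weighted_norm \<rho> (l + 3) \<Phi>)"
      by (subst sum.union_disjoint) (auto simp: sum.reindex)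
    also have "(\<Sum>l\<le>k. weighted_norm \<rho> (l + 3) \<Phi>) \<le> (\<Sum>l\<le>k. \<Sum>\<gamma>\<in>UNIV. \<Sum>\<beta>\<in>UNIV. \<Sum>\<alpha>\<in>UNIV.
        weighted_norm \<rho> l (?d \<alpha> \<beta> \<gamma>) * \<rho> ^ 3)"
    proof (rule sum_mono)
      fix l
      show "weighted_norm \<rho> (l + 3) \<Phi> \<le> (\<Sum>\<gamma>\<in>UNIV. \<Sum>\<beta>\<in>UNIV. \<Sum>\<alpha>\<in>UNIV.
          weighted_norm \<rho> l (?d \<alpha> \<beta> \<gamma>) * \<rho> ^ 3)"
        using mult_right_mono [OF degree_norm_third_deriv_le [of l \<Phi>], of "\<rho> ^ (l + 3)"] assms(1)
        by (simp add: weighted_norm_def sum_distrib_right power_add mult.assoc)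
    qed
    also have "\<dots> = (\<Sum>\<gamma>\<in>UNIV. \<Sum>\<beta>\<in>UNIV. \<Sum>\<alpha>\<in>UNIV. \<Sum>l\<le>k. weighted_norm \<rho> l (?d \<alpha> \<beta> \<gamma>)) * \<rho> ^ 3"
      by (simp add: sum_distrib_right sum.swap [of _ _ "{..k}"])
    also have "\<dots> \<le> (\<Sum>\<gamma>\<in>UNIV. \<Sum>\<beta>\<in>UNIV. \<Sum>\<alpha>\<in>UNIV. C \<alpha> \<beta> \<gamma>) * \<rho> ^ 3"
      using assms(1) by (intro mult_right_mono sum_mono C) auto
    finally show ?thesis
      by (simp add: B_def)
  qed
  then have "t \<in> abs_conv_points \<Phi>" if "norm t < \<rho>" for t
    using that assms(1) Finite_Cartesian_Product.norm_nth_le [of t]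
    by (intro abs_conv_points_if_weighted_norm_bounded [of \<rho> \<Phi> B]) (auto intro: less_imp_le order_trans [of _ "norm t"])
  then have "ball 0 \<rho> \<subseteq> abs_conv_points \<Phi>"
    by auto
  then have "0 \<in> convergence_domain \<Phi>"
    unfolding convergence_domain_def using assms(1) by (meson centre_in_ball interiorI open_ball)
  then show ?thesis
    by blast
qed

theorem theorem5p1:
  fixes scale :: "complex \<Rightarrow> 'h::ab_group_add \<Rightarrow> 'h"
    and \<Delta> :: "'n::finite \<Rightarrow> 'h"
    and \<eta> :: "'h \<Rightarrow> 'h \<Rightarrow> complex"
    and \<Phi> :: "(complex, 'n) mfps"
    and i\<^sub>1 :: 'n
    and E :: "'n vfield"
  assumes "semisimple_formal_frobenius_manifold scale \<Delta> \<eta> \<Phi> i\<^sub>1 E"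
  shows "convergence_domain \<Phi> \<noteq> {}"
proof -
  interpret semisimple_formal_frobenius_manifold scale \<Delta> \<eta> \<Phi> i\<^sub>1 E
    by (rule assms)
  obtain \<phi> where "semisimple_flat_F_manifold (struct_const \<Phi>) i\<^sub>1 E \<phi>"
    using struct_const_semisimple_flat_F_manifold by blast
  then interpret F: semisimple_flat_F_manifold "struct_const \<Phi>" i\<^sub>1 E \<phi> .
  obtain \<rho> where \<rho>: "\<rho> > 0" "\<forall>f\<in>F.\<A>. \<exists>C. \<forall>k. (\<Sum>l\<le>k. weighted_norm \<rho> l f) \<le> C"
    using F.structure_constants_convergent by blast
  have "third_deriv \<Phi> \<alpha> \<beta> \<gamma> \<in> F.\<A>" for \<alpha> \<beta> \<gamma>
    unfolding third_deriv_eq_struct_const by (intro F.\<A>_intros)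
  then show ?thesis
    using \<rho> by (intro convergence_domain_nonempty [of \<rho>]) (auto simp: third_deriv_def)
qed

end
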